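(* Let $\frac12\le s<1$. Let $(\delta_n)_{n\in\mathbb N}$ be a sequence of positive numbers with $\delta_n\to0$; set $\Lambda_n:=1/\delta_n$, let $T_n=L_n(\Lambda_n+1)\delta_n$ with $L_n\in\mathbb N$, and let $u_n$ be a minimizer of $\mathcal F^{T_n}_s$ in $\mathscr A^{T_n,\Lambda_n,\delta_n}$. Then $$\lim_{n\to\infty}\frac1{\sigma_n}\mathcal F^{T_n}_s(u_n)=1,$$ where $\sigma_n:=\log\frac1{\delta_n}$ if $s=\frac12$, and $\sigma_n:=\dfrac{\delta_n^{1-2s}}{2s(1-s)(2s-1)(3-2s)}$ if $\frac12<s<1$.
   Context: For $\Lambda,\delta>0$ and $T=L(\Lambda+1)\delta$ with $L\in\mathbb N$, the admissible class $\mathscr A^{T,\Lambda,\delta}$ is the set of continuous, $T$-periodic, piecewise affine functions $u:\mathbb R\to\mathbb R$ with $u'\in\{1,-\Lambda\}$ a.e., such that $(u')^{-1}(\{-\Lambda\})=\bigcup_{k\in\mathbb N}I^k$ for some intervals $I^k$ with $|I^k|=\delta$ for all $k$ and $\#(I^i\cap I^j)\le1$ for all $i\ne j$. For $0<s<1$, $$\mathcal F^T_s(u):=\frac1{2T}\int_0^T dx\int_{\mathbb R}\frac{|u(x)-u(y)|^2}{|x-y|^{1+2s}}\,dy.$$ *)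

theory Defs
  imports "HOL-Analysis.Analysis"
begin

definition interval_of_length :: "real \<Rightarrow> real set \<Rightarrow> bool" where
  "interval_of_length \<delta> I \<longleftrightarrow> (\<exists>a. {a<..<a+\<delta>} \<subseteq> I \<and> I \<subseteq> {a..a+\<delta>})"

definition admissible :: "real \<Rightarrow> real \<Rightarrow> real \<Rightarrow> (real \<Rightarrow> real) \<Rightarrow> bool" where
  "admissible T \<Lambda> \<delta> u \<longleftrightarrow>
     continuous_on UNIV u \<and>
     (\<forall>x. u (x + T) = u x) \<and>
     (\<exists>D :: real set. \<exists>I :: nat \<Rightarrow> real set.
        (\<forall>a b. finite (D \<inter> {a..b})) \<and>
        (\<forall>k. interval_of_length \<delta> (I k)) \<and>
        (\<forall>i j. i \<noteq> j \<longrightarrow> (\<forall>x y. x \<in> I i \<inter> I j \<longrightarrow> y \<in> I i \<inter> I j \<longrightarrow> x = y)) \<and>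
        (\<forall>x. x \<notin> D \<longrightarrow>
           ((u has_real_derivative (if x \<in> (\<Union>k. I k) then - \<Lambda> else 1)) (at x))))"

definition energy :: "real \<Rightarrow> real \<Rightarrow> (real \<Rightarrow> real) \<Rightarrow> ennreal" where
  "energy T s u = ennreal (1 / (2 * T)) *
     (\<integral>\<^sup>+ x. indicator {0..T} x *
        (\<integral>\<^sup>+ y. ennreal (\<bar>u x - u y\<bar>\<^sup>2 / \<bar>x - y\<bar> powr (1 + 2 * s)) \<partial>lborel) \<partial>lborel)"

definition is_minimizer :: "real \<Rightarrow> real \<Rightarrow> real \<Rightarrow> real \<Rightarrow> (real \<Rightarrow> real) \<Rightarrow> bool" where
  "is_minimizer T \<Lambda> \<delta> s u \<longleftrightarrow>
     admissible T \<Lambda> \<delta> u \<and> (\<forall>v. admissible T \<Lambda> \<delta> v \<longrightarrow> energy T s u \<le> energy T s v)"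

end

theory Submission
  imports Defs
begin

text \<open>
  Put \<open>U x = (x - u x) / (1 + \<Lambda>)\<close>. Then \<open>U (x + h) - U x\<close> is the length of the falling
  set inside \<open>[x, x + h]\<close>, and since \<open>u\<close> is periodic the mean of \<open>(u (x + h) - u x)\<^sup>2\<close> is
  the mean of \<open>((1 + \<Lambda>) (U (x + h) - U x))\<^sup>2\<close> minus \<open>h\<^sup>2\<close>. That length is the sum of the
  overlaps of \<open>[x, x + h]\<close> with the individual falling intervals, so its square is at least
  the sum of the squared overlaps, with equality when \<open>[x, x + h]\<close> never meets two falling
  intervals. The sawtooth with equidistant falling intervals has gaps of length 1, hence it
  attains the bound for every \<open>h \<le> 1\<close>, while the increments with \<open>h > 1\<close> contribute at
  most \<open>1 / (2 s)\<close> to its energy. The minimal energy is therefore known up to \<open>1 / (2 s)\<close>,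
  and the explicit part is asymptotic to \<open>\<sigma>\<close>.
\<close>

section \<open>Integrals of periodic functions and of squared ramp increments\<close>

text \<open>For a \<le> b, split [a, b + P] once at b and once at a + P. The leftover pieces [a, b]
  and [a + P, b + P] are translates by one period and cancel.\<close>

lemma integral_period_shift:
  fixes F :: "real \<Rightarrow> real"
  assumes cont: "continuous_on UNIV F" and per: "\<And>x. F (x + P) = F x" and P: "P \<ge> 0"
  shows "integral {a..a+P} F = integral {b..b+P} F"
proof -
  have int: "F integrable_on {c..d}" for c d
    by (rule integrable_continuous_real, rule continuous_on_subset[OF cont]) auto
  have "integral {a..a+P} F = integral {b..b+P} F" if "a \<le> b" for a b
  proof -
    have "integral {a..b} F + integral {b..b+P} F = integral {a..b+P} F"
      using that P by (intro Henstock_Kurzweil_Integration.integral_combine int) auto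
    moreover have "integral {a..a+P} F + integral {a+P..b+P} F = integral {a..b+P} F"
      using that P by (intro Henstock_Kurzweil_Integration.integral_combine int) auto
    moreover have "integral {a+P..b+P} F = integral {a..b} F"
      using integral_shift_real_ivl[of "a+P" P "b+P" F] by (simp add: per)
    ultimately show ?thesis by simp
  qed
  then show ?thesis by (cases "a \<le> b") (metis, metis linear)
qed

lemma periodic_add_mult:
  fixes F :: "real \<Rightarrow> 'a"
  assumes "\<And>x. F (x + P) = F x"
  shows "F (x + real N * P) = F x"
proof (induction N)
  case (Suc N)
  have "F (x + real (Suc N) * P) = F ((x + real N * P) + P)"
    by (simp add: algebra_simps)
  with Suc assms show ?case by metis
qed auto

lemma integral_periods:
  fixes F :: "real \<Rightarrow> real"
  assumes cont: "continuous_on UNIV F" and per: "\<And>x. F (x + P) = F x" and P: "P \<ge> 0"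
  shows "integral {a..a+real N*P} F = real N * integral {b..b+P} F"
proof (induction N)
  case (Suc N)
  have int: "F integrable_on {c..d}" for c d
    by (rule integrable_continuous_real, rule continuous_on_subset[OF cont]) auto
  have "integral {a..a+real N*P} F + integral {a+real N*P..a+real (Suc N)*P} F
        = integral {a..a+real (Suc N)*P} F"
    using P by (intro Henstock_Kurzweil_Integration.integral_combine int) (auto simp: algebra_simps)
  moreover have "integral {a+real N*P..a+real (Suc N)*P} F = integral {b..b+P} F"
    using integral_period_shift[OF assms, of "a+real N*P" b] by (simp add: algebra_simps)
  ultimately show ?case using Suc by (simp add: algebra_simps)
qed auto

text \<open>Comparisons between the fall function and sums of ramps go through this form: such
  functions are continuous but lack a known derivative at their breakpoints, which are finitely many
  on a bounded interval.\<close>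

lemma le_of_deriv_nonneg_except_finite:
  fixes f f' :: "real \<Rightarrow> real"
  assumes "a \<le> b" and cont: "continuous_on {a..b} f" and "finite E"
    and der: "\<And>x. \<lbrakk>a < x; x < b; x \<notin> E\<rbrakk> \<Longrightarrow> (f has_real_derivative f' x) (at x)"
    and nonneg: "\<And>x. \<lbrakk>a < x; x < b; x \<notin> E\<rbrakk> \<Longrightarrow> f' x \<ge> 0"
  shows "f a \<le> f b"
proof -
  define g where "g x = (if x \<in> {a<..<b} - E then f' x else 0)" for x
  have "(g has_integral f b - f a) {a..b}"
    by (rule fundamental_theorem_of_calculus_interior_strong[OF \<open>finite E\<close> \<open>a \<le> b\<close> _ cont])
       (auto simp: g_def der simp flip: has_real_derivative_iff_has_vector_derivative)
  then have "0 \<le> f b - f a"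
    by (rule has_integral_nonneg) (auto simp: g_def nonneg)
  then show ?thesis by simp
qed

text \<open>For \<delta> \<ge> 0 this is the length of [a, a + \<delta>] below x, so the increment
  from x to x + h is the length of the overlap of [x, x + h] with [a, a + \<delta>].\<close>

definition ramp :: "real \<Rightarrow> real \<Rightarrow> real \<Rightarrow> real" where
  "ramp \<delta> a x = min \<delta> (max 0 (x - a))"

lemma continuous_on_ramp [continuous_intros]: "continuous_on A (ramp \<delta> a)"
  unfolding ramp_def by (intro continuous_intros)

lemma ramp_mono: "x \<le> y \<Longrightarrow> ramp \<delta> a x \<le> ramp \<delta> a y"
  by (auto simp: ramp_def)

lemma ramp_diff_le: "\<delta> \<ge> 0 \<Longrightarrow> ramp \<delta> a y - ramp \<delta> a x \<le> \<delta>"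
  by (auto simp: ramp_def)

lemma ramp_deriv:
  assumes "x \<noteq> a" "x \<noteq> a + \<delta>" "\<delta> > 0"
  shows "(ramp \<delta> a has_real_derivative (if x \<in> {a<..<a+\<delta>} then 1 else 0)) (at x)"
proof -
  consider "x < a" | "a < x" "x < a + \<delta>" | "a + \<delta> < x" using assms by linarith
  then show ?thesis
  proof cases
    case 1
    have "((\<lambda>x. 0) has_real_derivative 0) (at x)" by simp
    then have "(ramp \<delta> a has_real_derivative 0) (at x)"
      by (rule has_field_derivative_transform_within_open[where S="{..<a}"]) (use 1 assms in \<open>auto simp: ramp_def\<close>)
    with 1 show ?thesis by auto
  next
    case 2
    have "((\<lambda>x. x - a) has_real_derivative 1) (at x)" by (auto intro!: derivative_eq_intros)
    then have "(ramp \<delta> a has_real_derivative 1) (at x)"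
      by (rule has_field_derivative_transform_within_open[where S="{a<..<a+\<delta>}"]) (use 2 assms in \<open>auto simp: ramp_def\<close>)
    with 2 show ?thesis by auto
  next
    case 3
    have "((\<lambda>x. \<delta>) has_real_derivative 0) (at x)" by simp
    then have "(ramp \<delta> a has_real_derivative 0) (at x)"
      by (rule has_field_derivative_transform_within_open[where S="{a+\<delta><..}"]) (use 3 assms in \<open>auto simp: ramp_def\<close>)
    with 3 show ?thesis by auto
  qed
qed

lemma sq_integral:
  fixes b c d :: real
  assumes "b \<le> c"
  shows "((\<lambda>x. (x-d)\<^sup>2) has_integral (c-d)^3/3 - (b-d)^3/3) {b..c}"
proof (rule fundamental_theorem_of_calculus[OF assms])
  fix x
  have "((\<lambda>x. (x-d)^3/3) has_real_derivative (x-d)\<^sup>2) (at x within {b..c})"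
    by (auto intro!: derivative_eq_intros simp: power2_eq_square)
  then show "((\<lambda>x. (x-d)^3/3) has_vector_derivative (x-d)\<^sup>2) (at x within {b..c})"
    by (simp add: has_real_derivative_iff_has_vector_derivative)
qed

text \<open>For positive h and \<delta>, the integral over all x of the squared overlap of
  [x, x + h] with a fixed interval of length \<delta>. It is symmetric in h and \<delta>.\<close>

definition overlap_sq :: "real \<Rightarrow> real \<Rightarrow> real" where
  "overlap_sq \<delta> h = (min h \<delta>)\<^sup>2 * max h \<delta> - (min h \<delta>)^3 / 3"

text \<open>As a function of x the overlap is a trapezoid: it climbs with slope 1 to the height p =
  min h \<delta>, stays there for a length q - p with q = max h \<delta>, and descends with slope
  -1. Each flank contributes p^3 / 3 and the plateau p^2 (q - p). Outside the stated interval the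
  overlap vanishes.\<close>

lemma ramp_increment_sq_integral:
  assumes "h > 0" "\<delta> > 0"
  shows "((\<lambda>x. (ramp \<delta> a (x + h) - ramp \<delta> a x)\<^sup>2) has_integral overlap_sq \<delta> h) {a-h..a+\<delta>}"
proof -
  define p q where "p = min h \<delta>" and "q = max h \<delta>"
  have pq: "0 < p" "p \<le> q" "p + q = h + \<delta>" using assms by (auto simp: p_def q_def)
  let ?f = "\<lambda>x. (ramp \<delta> a (x + h) - ramp \<delta> a x)\<^sup>2"
  have 1: "(?f has_integral p^3/3) {a-h..a-h+p}"
  proof (rule has_integral_eq)
    show "((\<lambda>x. (x-(a-h))\<^sup>2) has_integral p^3/3) {a-h..a-h+p}"
      using sq_integral[of "a-h" "a-h+p" "a-h"] pq by simp
  qed (use assms in \<open>auto simp: ramp_def p_def\<close>)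
  have 2: "(?f has_integral p\<^sup>2*(q-p)) {a-h+p..a-h+q}"
  proof (rule has_integral_eq)
    show "((\<lambda>x. p\<^sup>2) has_integral p\<^sup>2*(q-p)) {a-h+p..a-h+q}"
      using has_integral_const_real[of "p\<^sup>2" "a-h+p" "a-h+q"] pq by (simp add: mult.commute)
  qed (use assms in \<open>auto simp: ramp_def p_def q_def min_def max_def split: if_splits\<close>)
  have 3: "(?f has_integral p^3/3) {a-h+q..a-h+q+p}"
  proof (rule has_integral_eq)
    show "((\<lambda>x. (x-(a+\<delta>))\<^sup>2) has_integral p^3/3) {a-h+q..a-h+q+p}"
    proof -
      have "a-h+q+p = a+\<delta>" "a-h+q = a+\<delta>-p" using pq by simp_all
      then show ?thesis using sq_integral[of "a+\<delta>-p" "a+\<delta>" "a+\<delta>"] pq by (simp only:) simp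
    qed
    fix x assume "x \<in> {a-h+q..a-h+q+p}"
    then have "ramp \<delta> a (x + h) - ramp \<delta> a x = -(x-(a+\<delta>))"
      using assms by (auto simp: ramp_def p_def q_def min_def max_def split: if_splits)
    then show "(x-(a+\<delta>))\<^sup>2 = ?f x" by (metis power2_minus)
  qed
  have "(?f has_integral p^3/3 + p\<^sup>2*(q-p)) {a-h..a-h+q}"
    by (rule has_integral_combine[OF _ _ 1 2]) (use pq in auto)
  then have "(?f has_integral p^3/3 + p\<^sup>2*(q-p) + p^3/3) {a-h..a-h+q+p}"
    by (rule has_integral_combine[OF _ _ _ 3, rotated 2]) (use pq in auto)
  moreover have "a-h+q+p = a+\<delta>" using pq by simp
  moreover have "p^3/3 + p\<^sup>2*(q-p) + p^3/3 = overlap_sq \<delta> h"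
    by (simp add: overlap_sq_def p_def[symmetric] q_def[symmetric] power3_eq_cube power2_eq_square algebra_simps)
  ultimately show ?thesis by simp
qed

section \<open>The energy as an integral over increments\<close>

definition increment_sq :: "real \<Rightarrow> (real \<Rightarrow> real) \<Rightarrow> real \<Rightarrow> real" where
  "increment_sq T u h = integral {0..T} (\<lambda>x. (u (x + h) - u x)\<^sup>2)"

lemma continuous_on_translate:
  fixes u :: "real \<Rightarrow> real"
  assumes "continuous_on UNIV u"
  shows "continuous_on A (\<lambda>x. u (x + h))"
  by (rule continuous_on_compose2[OF assms]) (auto intro!: continuous_intros)

lemma continuous_on_increment_sq:
  fixes u :: "real \<Rightarrow> real"
  assumes "continuous_on UNIV u"
  shows "continuous_on A (\<lambda>x. (u (x + h) - u x)\<^sup>2)"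
  using continuous_on_translate[OF assms, of A h] continuous_on_subset[OF assms, of A]
  by (intro continuous_intros) auto

text \<open>Translating x by h exchanges the two points of the increment, and periodicity moves the
  domain of integration back.\<close>

lemma increment_sq_minus:
  assumes cont: "continuous_on UNIV u" and per: "\<And>x. u (x + T) = u x" and T: "T \<ge> 0"
  shows "increment_sq T u (-h) = increment_sq T u h"
proof -
  let ?F = "\<lambda>x. (u (x + h) - u x)\<^sup>2"
  have "u (x + T + h) = u (x + h)" for x using per[of "x+h"] by (simp add: add_ac)
  then have "integral {-h..-h+T} ?F = integral {0..0+T} ?F"
    by (intro integral_period_shift continuous_on_increment_sq cont T) (simp add: per)
  moreover have "increment_sq T u (-h) = integral {-h..T-h} ?F"
    unfolding increment_sq_def
    using integral_shift_real_ivl[of "-h" "-h" "T-h" ?F] by (simp add: power2_commute)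
  ultimately show ?thesis by (simp add: increment_sq_def)
qed

text \<open>Substitute y = x + h and exchange the integrals by Tonelli. The integrand in h is even
  by \<open>increment_sq_minus\<close>, so folding onto h > 0 gives a factor 2 that turns 1 / (2 T)
  into 1 / T.\<close>

lemma energy_eq_increment_integral:
  assumes cont: "continuous_on UNIV u" and per: "\<And>x. u (x + T) = u x" and T: "T > 0"
  shows "energy T s u = (\<integral>\<^sup>+h. ennreal (increment_sq T u h / T / h powr (1 + 2 * s)) * indicator {0<..} h \<partial>lborel)"
proof -
  have [measurable]: "u \<in> borel_measurable borel"
    by (rule borel_measurable_continuous_onI[OF cont])
  define k where "k h = \<bar>h\<bar> powr (1 + 2 * s)" for h :: real
  have [measurable]: "k \<in> borel_measurable borel" unfolding k_def by measurable
  define f where "f x h = ennreal ((u (x + h) - u x)\<^sup>2 / k h) * indicator {0..T} x" for x h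
  define A where "A h = (\<integral>\<^sup>+x. f x h \<partial>lborel)" for h
  have f_meas [measurable]: "case_prod f \<in> borel_measurable (lborel \<Otimes>\<^sub>M lborel)"
    unfolding f_def by measurable
  have A_meas [measurable]: "A \<in> borel_measurable borel"
    unfolding A_def by measurable
  have A_eq: "A h = ennreal (increment_sq T u h / k h)" for h
    unfolding A_def f_def
  proof (rule nn_integral_has_integral_lebesgue')
    have "((\<lambda>x. (u (x + h) - u x)\<^sup>2) has_integral increment_sq T u h) {0..T}"
      unfolding increment_sq_def
      by (intro integrable_integral integrable_continuous_real continuous_on_increment_sq cont)
    from has_integral_divide[OF this]
    show "((\<lambda>x. (u (x + h) - u x)\<^sup>2 / k h) has_integral increment_sq T u h / k h) {0..T}" .
  qed (simp add: k_def)
  have inner: "indicator {0..T} x * (\<integral>\<^sup>+ y. ennreal (\<bar>u x - u y\<bar>\<^sup>2 / \<bar>x - y\<bar> powr (1 + 2 * s)) \<partial>lborel)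
      = (\<integral>\<^sup>+h. f x h \<partial>lborel)" for x
  proof -
    have "(\<integral>\<^sup>+ y. ennreal (\<bar>u x - u y\<bar>\<^sup>2 / \<bar>x - y\<bar> powr (1 + 2 * s)) \<partial>lborel)
       = \<bar>1::real\<bar> * (\<integral>\<^sup>+ h. ennreal (\<bar>u x - u (x + 1 * h)\<bar>\<^sup>2 / \<bar>x - (x + 1 * h)\<bar> powr (1 + 2 * s)) \<partial>lborel)"
      by (rule nn_integral_real_affine) auto
    also have "\<dots> = (\<integral>\<^sup>+ h. ennreal ((u (x + h) - u x)\<^sup>2 / k h) \<partial>lborel)"
      by (simp add: k_def power2_commute)
    finally show ?thesis
      unfolding f_def by (subst nn_integral_multc) (auto simp: mult.commute)
  qed
  let ?B = "\<integral>\<^sup>+h. A h * indicator {0<..} h \<partial>lborel"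
  have energy: "energy T s u = ennreal (1 / (2 * T)) * (\<integral>\<^sup>+x. (\<integral>\<^sup>+h. f x h \<partial>lborel) \<partial>lborel)"
    unfolding energy_def inner ..
  have fubini: "(\<integral>\<^sup>+x. (\<integral>\<^sup>+h. f x h \<partial>lborel) \<partial>lborel) = (\<integral>\<^sup>+h. A h \<partial>lborel)"
    unfolding A_def by (rule lborel_pair.Fubini'[symmetric]) (rule f_meas)
  have "A h = A h * indicator {0<..} h + A h * indicator {..<0} h" for h
  proof -
    have "A 0 = 0" by (simp add: A_eq k_def)
    then show ?thesis
      by (cases h "0::real" rule: linorder_cases) auto
  qed
  then have "(\<integral>\<^sup>+h. A h \<partial>lborel) = (\<integral>\<^sup>+h. A h * indicator {0<..} h + A h * indicator {..<0} h \<partial>lborel)"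
    by presburger
  then have split: "(\<integral>\<^sup>+h. A h \<partial>lborel) = ?B + (\<integral>\<^sup>+h. A h * indicator {..<0} h \<partial>lborel)"
    by (simp add: nn_integral_add)
  have "A (-h) = A h" for h
    using T by (simp add: A_eq k_def increment_sq_minus[OF cont per])
  then have "(\<integral>\<^sup>+h. A h * indicator {..<0} h \<partial>lborel) = ?B"
    using nn_integral_real_affine[where f = "\<lambda>h. A h * indicator {..<0} h" and t=0 and c="-1"]
    by (simp add: indicator_def)
  then have "energy T s u = ennreal (1 / (2 * T)) * (2 * ?B)"
    unfolding energy fubini split mult_2 by (rule arg_cong)
  moreover have "ennreal (1 / (2 * T)) * 2 = ennreal (1 / T)"
    using ennreal_mult[of "1 / (2 * T)" 2] T by simp
  ultimately have "energy T s u = ennreal (1 / T) * ?B"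
    by (metis mult.assoc)
  also have "\<dots> = (\<integral>\<^sup>+h. ennreal (1 / T) * (A h * indicator {0<..} h) \<partial>lborel)"
    by (rule nn_integral_cmult[symmetric]) auto
  also have "\<dots> = (\<integral>\<^sup>+h. ennreal (increment_sq T u h / T / h powr (1 + 2 * s)) * indicator {0<..} h \<partial>lborel)"
    using T by (intro nn_integral_cong)
      (auto simp: A_eq k_def indicator_def mult.commute simp flip: ennreal_mult')
  finally show ?thesis .
qed

section \<open>The lower bound for increments\<close>

text \<open>Each cell of the grid with mesh \<delta> contains at most one of the points, so the cell
  number is injective, and only finitely many cells meet [lo, hi].\<close>

lemma fixed_gap_finite:
  fixes a :: "nat \<Rightarrow> real"
  assumes \<delta>: "\<delta> > 0" and gap: "\<And>i j. i \<noteq> j \<Longrightarrow> \<bar>a i - a j\<bar> \<ge> \<delta>"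
  shows "finite {k. lo \<le> a k \<and> a k \<le> hi}"
proof (rule inj_on_finite)
  show "inj_on (\<lambda>k. \<lfloor>a k / \<delta>\<rfloor>) {k. lo \<le> a k \<and> a k \<le> hi}"
  proof (rule inj_onI)
    fix i j assume eq: "\<lfloor>a i / \<delta>\<rfloor> = \<lfloor>a j / \<delta>\<rfloor>"
    have "\<bar>a i / \<delta> - a j / \<delta>\<bar> < 1" using eq by linarith
    then have "\<bar>a i - a j\<bar> < \<delta>"
      using \<delta> by (simp add: abs_less_iff field_simps)
    then show "i = j" using gap[of i j] by force
  qed
  show "(\<lambda>k. \<lfloor>a k / \<delta>\<rfloor>) ` {k. lo \<le> a k \<and> a k \<le> hi} \<subseteq> {\<lfloor>lo / \<delta>\<rfloor>..\<lfloor>hi / \<delta>\<rfloor>}"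
    using \<delta> by (auto intro!: floor_mono divide_right_mono)
qed auto

text \<open>With closer left endpoints the open intervals would overlap in a nonempty open interval,
  which has two distinct points.\<close>

lemma disjoint_intervals_gap:
  fixes a b \<delta> :: real
  assumes \<delta>: "\<delta> > 0"
    and I: "{a<..<a+\<delta>} \<subseteq> I" "{b<..<b+\<delta>} \<subseteq> J"
    and one: "\<And>x y. x \<in> I \<inter> J \<Longrightarrow> y \<in> I \<inter> J \<Longrightarrow> x = y"
  shows "\<bar>a - b\<bar> \<ge> \<delta>"
proof (rule ccontr)
  assume "\<not> ?thesis"
  then have "max a b < min (a+\<delta>) (b+\<delta>)" by (auto simp: abs_if split: if_splits)
  then obtain x y where "max a b < x" "x < y" "y < min (a+\<delta>) (b+\<delta>)"
    by (meson dense)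
  then have "x \<in> I \<inter> J" "y \<in> I \<inter> J" "x \<noteq> y" using I by auto
  with one show False by blast
qed

text \<open>The cross terms are nonnegative. Dropping them is what discards the interaction between
  different falling intervals in the lower bound.\<close>

lemma sum_power2_le:
  fixes f :: "'a \<Rightarrow> real"
  assumes "finite K" "\<And>k. k \<in> K \<Longrightarrow> f k \<ge> 0"
  shows "(\<Sum>k\<in>K. (f k)\<^sup>2) \<le> (\<Sum>k\<in>K. f k)\<^sup>2"
  using assms
proof (induction K rule: finite_induct)
  case (insert k K)
  have "(f k)\<^sup>2 + (sum f K)\<^sup>2 \<le> (f k + sum f K)\<^sup>2"
    using insert by (simp add: power2_sum sum_nonneg)
  then show ?case using insert by auto
qed auto

text \<open>The normalisation by 1 + \<Lambda> turns the slopes 1 and -\<Lambda> of u into 0 and 1.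
  The falling set S is only sandwiched between open and closed intervals, so it does not matter
  which endpoints the given intervals contain.\<close>

lemma admissible_fall_function:
  assumes adm: "admissible T \<Lambda> \<delta> u" and \<delta>: "\<delta> > 0" and \<Lambda>: "\<Lambda> > 0"
  defines "U \<equiv> \<lambda>x. (x - u x) / (1 + \<Lambda>)"
  obtains D a S where
    "\<And>lo hi. finite (D \<inter> {lo..hi})"
    "\<And>i j. i \<noteq> j \<Longrightarrow> \<bar>a i - a j\<bar> \<ge> \<delta>"
    "\<And>k. {a k<..<a k+\<delta>} \<subseteq> S" "S \<subseteq> (\<Union>k::nat. {a k..a k+\<delta>})"
    "\<And>x. x \<notin> D \<Longrightarrow> (U has_real_derivative indicator S x) (at x)"
    "\<And>A. continuous_on A U"
proof -
  from adm obtain D I where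
    cont: "continuous_on UNIV u"
    and D: "\<And>a b. finite (D \<inter> {a..b})"
    and I: "\<And>k. interval_of_length \<delta> (I k)"
    and disj: "\<And>i j x y. i \<noteq> j \<Longrightarrow> x \<in> I i \<inter> I j \<Longrightarrow> y \<in> I i \<inter> I j \<Longrightarrow> x = y"
    and der: "\<And>x. x \<notin> D \<Longrightarrow>
      (u has_real_derivative (if x \<in> (\<Union>k::nat. I k) then - \<Lambda> else 1)) (at x)"
    unfolding admissible_def by metis
  from I obtain a where a: "\<And>k. {a k<..<a k+\<delta>} \<subseteq> I k" "\<And>k. I k \<subseteq> {a k..a k+\<delta>}"
    unfolding interval_of_length_def by metis
  show thesis
  proof (rule that[of D a "\<Union>k. I k"])
    show "\<bar>a i - a j\<bar> \<ge> \<delta>" if "i \<noteq> j" for i j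
      by (rule disjoint_intervals_gap[OF \<delta> a(1) a(1) disj[OF that]])
    show "(U has_real_derivative indicator (\<Union>k. I k) x) (at x)" if "x \<notin> D" for x
      unfolding U_def using der[OF that] \<Lambda>
      by (auto intro!: derivative_eq_intros simp: indicator_def)
    show "continuous_on A U" for A
      unfolding U_def using \<Lambda> by (intro continuous_intros continuous_on_subset[OF cont]) auto
    show "{a k<..<a k+\<delta>} \<subseteq> (\<Union>k. I k)" for k using a(1) by blast
    show "(\<Union>k. I k) \<subseteq> (\<Union>k. {a k..a k+\<delta>})" using a(2) by blast
  qed (rule D)
qed

text \<open>With d x = u (x + h) - u x one has (1 + \<Lambda>) (U (x + h) - U x) = h - d x.
  Expanding the square, the cross term drops out because d has integral 0 over whole
  periods.\<close>

lemma fall_increment_integral: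
  fixes u :: "real \<Rightarrow> real"
  assumes cont: "continuous_on UNIV u" and per: "\<And>x. u (x + T) = u x" and T: "T \<ge> 0" and \<Lambda>: "\<Lambda> > 0"
  defines "U \<equiv> \<lambda>x. (x - u x) / (1 + \<Lambda>)"
  shows "(1 + \<Lambda>)\<^sup>2 * integral {b..b + real N * T} (\<lambda>x. (U (x + h) - U x)\<^sup>2)
    = real N * (increment_sq T u h + T * h\<^sup>2)"
proof -
  let ?J = "{b..b + real N * T}"
  define d where "d x = u (x + h) - u x" for x
  have contd: "continuous_on A d" for A
    unfolding d_def
    by (intro continuous_intros continuous_on_translate[OF cont] continuous_on_subset[OF cont]) auto
  have d_per: "d (x + T) = d x" for x
    using per[of x] per[of "x+h"] by (simp add: d_def add_ac)
  have u_int: "u integrable_on {c..e}" "(\<lambda>x. u (x+h)) integrable_on {c..e}" for c e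
    by (auto intro!: integrable_continuous_real continuous_on_translate[OF cont] continuous_on_subset[OF cont])
  have "integral ?J (\<lambda>x. u (x+h)) = integral {b+h..b+h+real N*T} u"
    using integral_shift_real_ivl[of "b+h" h "b+h+real N*T" u] by (simp add: add_ac)
  also have "\<dots> = integral ?J u"
    using integral_periods[OF cont per T] by metis
  finally have int_d: "integral ?J d = 0"
    unfolding d_def by (simp add: Henstock_Kurzweil_Integration.integral_diff u_int)
  have int_d2: "integral ?J (\<lambda>x. (d x)\<^sup>2) = real N * increment_sq T u h"
    using integral_periods[of "\<lambda>x. (d x)\<^sup>2" T b N 0] T continuous_on_power[OF contd, of UNIV 2]
    by (simp add: d_per increment_sq_def) (simp add: d_def)
  have "(d has_integral 0) ?J"
    by (simp add: has_integral_iff int_d integrable_continuous_real contd)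
  moreover have "((\<lambda>x. (d x)\<^sup>2) has_integral real N * increment_sq T u h) ?J"
    by (simp add: has_integral_iff int_d2 integrable_continuous_real continuous_on_power contd)
  moreover have "((\<lambda>x. h\<^sup>2) has_integral real N * T * h\<^sup>2) ?J"
    using has_integral_const_real[of "h\<^sup>2" b "b + real N * T"] T by simp
  ultimately have "((\<lambda>x. h\<^sup>2 - 2 * h * d x + (d x)\<^sup>2) has_integral real N * T * h\<^sup>2 - 2 * h * 0 + real N * increment_sq T u h) ?J"
    by (intro has_integral_add has_integral_diff has_integral_mult_right)
  moreover have "h\<^sup>2 - 2 * h * d x + (d x)\<^sup>2 = (1 + \<Lambda>)\<^sup>2 * (U (x + h) - U x)\<^sup>2" for x
  proof -
    have "U (x + h) - U x = (h - d x) / (1 + \<Lambda>)"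
      by (simp add: U_def d_def flip: diff_divide_distrib)
    then have "(1 + \<Lambda>) * (U (x + h) - U x) = h - d x"
      using \<Lambda> by simp
    then have "(1 + \<Lambda>)\<^sup>2 * (U (x + h) - U x)\<^sup>2 = (h - d x)\<^sup>2"
      by (simp flip: power_mult_distrib)
    then show ?thesis by (simp add: power2_diff)
  qed
  ultimately show ?thesis
    by (simp add: has_integral_iff algebra_simps)
qed

text \<open>The gap condition makes the open intervals disjoint, so at most one summand is
  nonzero.\<close>

lemma sum_disjoint_slopes:
  fixes a :: "nat \<Rightarrow> real"
  assumes gap: "\<And>i j. i \<noteq> j \<Longrightarrow> \<bar>a i - a j\<bar> \<ge> \<delta>" and "finite K"
  shows "(\<Sum>k\<in>K. if x \<in> {a k<..<a k+\<delta>} then 1 else 0 :: real)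
    = (if \<exists>k\<in>K. x \<in> {a k<..<a k+\<delta>} then 1 else 0)"
proof (cases "\<exists>k\<in>K. x \<in> {a k<..<a k+\<delta>}")
  case True
  then obtain k where k: "k \<in> K" "x \<in> {a k<..<a k+\<delta>}" by blast
  have "x \<in> {a j<..<a j+\<delta>} \<longleftrightarrow> j = k" for j
    using k(2) gap[of j k] by (cases "j = k") (auto simp: abs_if split: if_splits)
  then show ?thesis using True k(1) \<open>finite K\<close> by simp
next
  case False
  then show ?thesis by (auto intro!: sum.neutral)
qed

lemma ramp_sum_deriv:
  fixes a :: "nat \<Rightarrow> real"
  assumes gap: "\<And>i j. i \<noteq> j \<Longrightarrow> \<bar>a i - a j\<bar> \<ge> \<delta>" and "finite K" and \<delta>: "\<delta> > 0"
    and x: "x \<notin> a ` K" "x \<notin> (\<lambda>k. a k + \<delta>) ` K"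
  shows "((\<lambda>x. \<Sum>k\<in>K. ramp \<delta> (a k) x) has_real_derivative
     (if \<exists>k\<in>K. x \<in> {a k<..<a k+\<delta>} then 1 else 0)) (at x)"
proof -
  have "((\<lambda>x. \<Sum>k\<in>K. ramp \<delta> (a k) x) has_real_derivative
     (\<Sum>k\<in>K. if x \<in> {a k<..<a k+\<delta>} then 1 else 0)) (at x)"
    by (rule DERIV_sum) (rule ramp_deriv, use x \<delta> in auto)
  then show ?thesis using sum_disjoint_slopes[OF gap \<open>finite K\<close>] by simp
qed

text \<open>Divide by N and let N grow: an error C that is bounded in N disappears. This removes the
  boundary effects of counting over finitely many periods.\<close>

lemma le_of_nat_mult_bound:
  fixes A B C :: real
  assumes "\<And>N. N \<ge> N0 \<Longrightarrow> real N * A \<le> real N * B + C"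
  shows "A \<le> B"
proof (rule ccontr)
  assume "\<not> A \<le> B"
  then have pos: "A - B > 0" by simp
  then obtain n where n: "C < real n * (A - B)" using reals_Archimedean3 by blast
  have "real n * (A - B) \<le> real (max n N0) * (A - B)"
    using pos by (intro mult_right_mono) auto
  with assms[of "max n N0"] n show False by (simp add: algebra_simps)
qed

text \<open>
  A period need not contain exactly \<open>L\<close> of the given intervals, so the intervals are counted
  over \<open>N\<close> periods, with an error that is bounded in \<open>N\<close>.
\<close>

lemma increment_sq_ge:
  assumes adm: "admissible T \<Lambda> \<delta> u" and \<delta>: "\<delta> > 0" and \<Lambda>: "\<Lambda> > 0" and h: "h > 0"
    and L: "L \<ge> 1" and T: "T = real L * (1 + \<Lambda>) * \<delta>"
  shows "increment_sq T u h \<ge> (1 + \<Lambda>)\<^sup>2 * real L * overlap_sq \<delta> h - T * h\<^sup>2"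
proof -
  define U where "U = (\<lambda>x. (x - u x) / (1 + \<Lambda>))"
  obtain D a S where
    D: "\<And>lo hi. finite (D \<inter> {lo..hi})" and
    gap: "\<And>i j. i \<noteq> j \<Longrightarrow> \<bar>a i - a j\<bar> \<ge> \<delta>" and
    aS: "\<And>k. {a k<..<a k+\<delta>} \<subseteq> S" and Sa: "S \<subseteq> (\<Union>k::nat. {a k..a k+\<delta>})" and
    der: "\<And>x. x \<notin> D \<Longrightarrow> (U has_real_derivative indicator S x) (at x)" and
    contU: "\<And>A. continuous_on A U"
    using admissible_fall_function[OF adm \<delta> \<Lambda>] unfolding U_def by blast
  have cont: "continuous_on UNIV u" and per: "\<And>x. u (x + T) = u x"
    using adm unfolding admissible_def by auto
  have Tpos: "T > 0" using T L \<Lambda> \<delta> by simp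
  \<comment> \<open>Bounds the fall near the two ends of the window by the length of those
    ends.\<close>
  have slope_le_1: "U y - U x \<le> y - x" if "x \<le> y" for x y
  proof -
    have "x - U x \<le> y - U y"
      by (rule le_of_deriv_nonneg_except_finite[OF that _ D[of x y], where f'="\<lambda>x. 1 - indicator S x"])
         (auto intro!: derivative_eq_intros der continuous_intros contU simp: indicator_def)
    then show ?thesis by simp
  qed
  have U_per: "U (real N * T) - U 0 = real N * real L * \<delta>" for N
  proof -
    have "u (0 + real N * T) = u 0" by (rule periodic_add_mult[of u, OF per])
    then have "U (real N * T) - U 0 = real N * T / (1 + \<Lambda>)" by (simp add: U_def diff_divide_distrib)
    then show ?thesis using T \<Lambda> by simp
  qed
  \<comment> \<open>Large enough to give h + \<delta> \<le> W - \<delta> for W = N T, so that the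
    window keeps an inner part.\<close>
  define N0 where "N0 = nat \<lceil>(h + 2 * \<delta>) / T\<rceil>"
  define \<phi> where "\<phi> = overlap_sq \<delta> h"
  have \<phi>: "\<phi> \<ge> 0"
    using ramp_increment_sq_integral[OF h \<delta>, of 0] unfolding \<phi>_def
    by (rule has_integral_nonneg) auto
  have "real N * (real L * \<phi>) \<le> real N * ((increment_sq T u h + T * h\<^sup>2) / (1 + \<Lambda>)\<^sup>2) + (h + 2 * \<delta>) / \<delta> * \<phi>"
    if N: "N \<ge> N0" for N
  proof -
    define W where "W = real N * T"
    have W: "h + 2 * \<delta> \<le> W"
    proof -
      have "(h + 2 * \<delta>) / T \<le> real N" using N unfolding N0_def by linarith
      then show ?thesis using Tpos by (simp add: W_def field_simps)
    qed
    \<comment> \<open>Exactly the indices with [a k - h, a k + \<delta>] inside [0, W]: for these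
      the whole integral \<open>overlap_sq \<delta> h\<close> is collected within the
      window.\<close>
    define K where "K = {k. h \<le> a k \<and> a k \<le> W - \<delta>}"
    have K: "finite K" unfolding K_def by (rule fixed_gap_finite[OF \<delta> gap])
    define R where "R x = (\<Sum>k\<in>K. ramp \<delta> (a k) x)" for x
    define E where "E lo hi = (D \<inter> {lo..hi}) \<union> a ` K \<union> (\<lambda>k. a k + \<delta>) ` K" for lo hi
    have E: "finite (E lo hi)" for lo hi using K D by (simp add: E_def)
    have contR: "continuous_on A R" for A unfolding R_def by (intro continuous_intros)
    have R_der: "(R has_real_derivative (if \<exists>k\<in>K. x \<in> {a k<..<a k+\<delta>} then 1 else 0)) (at x)"
      if "x \<notin> E lo hi" for x lo hi
      unfolding R_def by (rule ramp_sum_deriv[OF gap K \<delta>]) (use that in \<open>auto simp: E_def\<close>)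
    have R_le_U: "R y - R x \<le> U y - U x" if "x \<le> y" for x y
    proof -
      have "U x - R x \<le> U y - R y"
      proof (rule le_of_deriv_nonneg_except_finite[OF that _ E[of x y],
            where f'="\<lambda>z. indicator S z - (if \<exists>k\<in>K. z \<in> {a k<..<a k+\<delta>} then 1 else 0)"])
        show "((\<lambda>x. U x - R x) has_real_derivative indicator S z - (if \<exists>k\<in>K. z \<in> {a k<..<a k+\<delta>} then 1 else 0)) (at z)"
          if "x < z" "z < y" "z \<notin> E x y" for z
          by (rule DERIV_diff[OF der R_der]) (use that in \<open>auto simp: E_def\<close>)
        show "indicator S z - (if \<exists>k\<in>K. z \<in> {a k<..<a k+\<delta>} then 1 else 0) \<ge> (0::real)" for z
          using subsetD[OF aS] by (auto simp: indicator_def)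
      qed (intro continuous_intros contU contR)
      then show ?thesis by simp
    qed
    \<comment> \<open>Between h + \<delta> and W - \<delta> the ramps of K account for all of the
      fall: if z there lies in [a k, a k + \<delta>], then h < a k < W - \<delta>, hence k is in
      K.\<close>
    have U_le_R: "U (W - \<delta>) - U (h + \<delta>) \<le> R (W - \<delta>) - R (h + \<delta>)"
    proof -
      have le: "h + \<delta> \<le> W - \<delta>" using W by simp
      have "R (h + \<delta>) - U (h + \<delta>) \<le> R (W - \<delta>) - U (W - \<delta>)"
      proof (rule le_of_deriv_nonneg_except_finite[OF le _ E[of "h + \<delta>" "W - \<delta>"],
            where f'="\<lambda>z. (if \<exists>k\<in>K. z \<in> {a k<..<a k+\<delta>} then 1 else 0) - indicator S z"])
        fix z assume z: "h + \<delta> < z" "z < W - \<delta>" "z \<notin> E (h + \<delta>) (W - \<delta>)"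
        show "((\<lambda>x. R x - U x) has_real_derivative (if \<exists>k\<in>K. z \<in> {a k<..<a k+\<delta>} then 1 else 0) - indicator S z) (at z)"
          by (rule DERIV_diff[OF R_der der]) (use z in \<open>auto simp: E_def\<close>)
        have "\<exists>k\<in>K. z \<in> {a k<..<a k+\<delta>}" if "z \<in> S"
        proof -
          obtain k where k: "a k \<le> z" "z \<le> a k + \<delta>" using subsetD[OF Sa \<open>z \<in> S\<close>] by auto
          then have "k \<in> K" using z by (auto simp: K_def)
          moreover have "z \<noteq> a k" "z \<noteq> a k + \<delta>" using z \<open>k \<in> K\<close> by (auto simp: E_def)
          ultimately show ?thesis using k by force
        qed
        then show "0 \<le> (if \<exists>k\<in>K. z \<in> {a k<..<a k+\<delta>} then 1 else 0) - (indicator S z :: real)"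
          by (auto simp: indicator_def)
      qed (intro continuous_intros contU contR)
      then show ?thesis by simp
    qed
    have "R (W - \<delta>) - R (h + \<delta>) \<le> real (card K) * \<delta>"
      unfolding R_def sum_subtractf[symmetric]
      by (rule sum_bounded_above[of K _ \<delta>, simplified]) (use \<delta> in \<open>auto intro!: ramp_diff_le\<close>)
    \<comment> \<open>The fall over [0, W] is N L \<delta>. The inner part contributes at most
      \<delta> for each index in K, and the end pieces, of lengths h + \<delta> and \<delta>, at
      most h + 2 \<delta> together.\<close>
    then have "real N * real L * \<delta> \<le> real (card K) * \<delta> + h + 2 * \<delta>"
      using U_le_R slope_le_1[of 0 "h + \<delta>"] slope_le_1[of "W - \<delta>" W] U_per[of N] h \<delta>
      by (simp add: W_def)
    then have "real N * real L \<le> real (card K) + (h + 2 * \<delta>) / \<delta>"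
      using \<delta> by (simp add: field_simps)
    then have "real N * real L * \<phi> \<le> (real (card K) + (h + 2 * \<delta>) / \<delta>) * \<phi>"
      using \<phi> by (rule mult_right_mono)
    moreover have "real (card K) * \<phi> \<le> integral {0..W} (\<lambda>x. (U (x + h) - U x)\<^sup>2)"
    proof -
      let ?g = "\<lambda>k x. (ramp \<delta> (a k) (x + h) - ramp \<delta> (a k) x)\<^sup>2"
      have g_int: "?g k integrable_on {c..d}" for k c d
        by (intro integrable_continuous_real continuous_intros
            continuous_on_compose2[OF continuous_on_ramp[of UNIV]]) auto
      have "\<phi> \<le> integral {0..W} (?g k)" if "k \<in> K" for k
      proof -
        have "\<phi> = integral {a k - h..a k + \<delta>} (?g k)"
          using ramp_increment_sq_integral[OF h \<delta>, of "a k"] by (simp add: \<phi>_def integral_unique)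
        also have "\<dots> \<le> integral {0..W} (?g k)"
          by (rule integral_subset_le) (use that g_int in \<open>auto simp: K_def\<close>)
        finally show ?thesis .
      qed
      then have "real (card K) * \<phi> \<le> (\<Sum>k\<in>K. integral {0..W} (?g k))"
        by (rule sum_bounded_below)
      also have "\<dots> = integral {0..W} (\<lambda>x. \<Sum>k\<in>K. ?g k x)"
        by (rule integral_sum[symmetric]) (use K g_int in auto)
      also have "\<dots> \<le> integral {0..W} (\<lambda>x. (U (x + h) - U x)\<^sup>2)"
      proof (rule integral_le)
        show "(\<lambda>x. \<Sum>k\<in>K. ?g k x) integrable_on {0..W}"
          by (rule integrable_sum) (use K g_int in auto)
        show "(\<lambda>x. (U (x + h) - U x)\<^sup>2) integrable_on {0..W}"
          by (intro integrable_continuous_real continuous_on_increment_sq contU)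
        fix x
        have "(\<Sum>k\<in>K. ?g k x) \<le> (\<Sum>k\<in>K. ramp \<delta> (a k) (x + h) - ramp \<delta> (a k) x)\<^sup>2"
          by (rule sum_power2_le[OF K]) (use h in \<open>auto intro!: ramp_mono\<close>)
        also have "\<dots> = (R (x + h) - R x)\<^sup>2"
          by (simp add: R_def sum_subtractf)
        also have "\<dots> \<le> (U (x + h) - U x)\<^sup>2"
          using R_le_U[of x "x + h"] h
          by (intro power_mono) (auto simp: R_def sum_subtractf[symmetric] intro!: sum_nonneg ramp_mono)
        finally show "(\<Sum>k\<in>K. ?g k x) \<le> (U (x + h) - U x)\<^sup>2" .
      qed
      finally show ?thesis .
    qed
    moreover have "integral {0..W} (\<lambda>x. (U (x + h) - U x)\<^sup>2)
        = real N * ((increment_sq T u h + T * h\<^sup>2) / (1 + \<Lambda>)\<^sup>2)"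
      using fall_increment_integral[OF cont per _ \<Lambda>, of 0 N h] Tpos \<Lambda>
      by (simp add: U_def W_def field_simps)
    ultimately show ?thesis by (simp add: distrib_right mult.assoc)
  qed
  \<comment> \<open>The error (h + 2 \<delta>) / \<delta> * \<phi> is independent of N.\<close>
  then have "real L * \<phi> \<le> (increment_sq T u h + T * h\<^sup>2) / (1 + \<Lambda>)\<^sup>2"
    by (rule le_of_nat_mult_bound)
  then show ?thesis using \<Lambda> by (simp add: \<phi>_def field_simps)
qed

section \<open>The sawtooth competitor\<close>

text \<open>Here t is the residue of x modulo the period 1 + \<delta>. For \<delta> > 0 the two
  lines cross at t = 1 with value 1, so each period has a rise of length 1 and a fall of length
  \<delta>.\<close>

definition sawtooth :: "real \<Rightarrow> real \<Rightarrow> real" where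
  "sawtooth \<delta> x = (let t = x - (1 + \<delta>) * of_int \<lfloor>x / (1 + \<delta>)\<rfloor> in min t ((1 + \<delta> - t) / \<delta>))"

lemma sawtooth_shift:
  assumes "\<delta> > 0"
  shows "sawtooth \<delta> (x + of_int m * (1 + \<delta>)) = sawtooth \<delta> x"
proof -
  have "(x + of_int m * (1 + \<delta>)) / (1 + \<delta>) = x / (1 + \<delta>) + of_int m"
    using assms by (simp add: field_simps)
  then have "\<lfloor>(x + of_int m * (1 + \<delta>)) / (1 + \<delta>)\<rfloor> = \<lfloor>x / (1 + \<delta>)\<rfloor> + m"
    by simp
  then show ?thesis by (simp add: sawtooth_def algebra_simps)
qed

lemma sawtooth_eq_min:
  assumes "\<delta> > 0" "of_int m * (1 + \<delta>) \<le> x" "x < of_int (m + 1) * (1 + \<delta>)"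
  shows "sawtooth \<delta> x = min (x - of_int m * (1 + \<delta>)) ((of_int (m + 1) * (1 + \<delta>) - x) / \<delta>)"
proof -
  have "\<lfloor>x / (1 + \<delta>)\<rfloor> = m"
    using assms by (simp add: floor_eq_iff field_simps)
  then show ?thesis by (simp add: sawtooth_def Let_def algebra_simps)
qed

lemma sawtooth_nonneg: "\<delta> > 0 \<Longrightarrow> sawtooth \<delta> x \<ge> 0"
  and sawtooth_le_1: "\<delta> > 0 \<Longrightarrow> sawtooth \<delta> x \<le> 1"
proof -
  assume \<delta>: "\<delta> > 0"
  define m where "m = \<lfloor>x / (1 + \<delta>)\<rfloor>"
  have m: "of_int m * (1 + \<delta>) \<le> x" "x < of_int (m + 1) * (1 + \<delta>)"
    using floor_divide_lower[of "1 + \<delta>" x] floor_divide_upper[of "1 + \<delta>" x] \<delta> by (auto simp: m_def)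
  note eq = sawtooth_eq_min[OF \<delta> this]
  show "sawtooth \<delta> x \<ge> 0" using m \<delta> by (simp add: eq)
  show "sawtooth \<delta> x \<le> 1"
  proof (cases "x - of_int m * (1 + \<delta>) \<le> 1")
    case False
    then have "(of_int (m + 1) * (1 + \<delta>) - x) / \<delta> \<le> 1"
      using \<delta> by (simp add: algebra_simps)
    then show ?thesis by (simp add: eq)
  qed (simp add: eq)
qed

lemma sawtooth_rising:
  assumes "\<delta> > 0" "of_int m * (1 + \<delta>) \<le> x" "x \<le> of_int m * (1 + \<delta>) + 1"
  shows "sawtooth \<delta> x = x - of_int m * (1 + \<delta>)"
proof -
  have "(x - of_int m * (1 + \<delta>)) * \<delta> \<le> of_int (m + 1) * (1 + \<delta>) - x"
    using mult_right_mono[of "x - of_int m * (1 + \<delta>)" 1 "1 + \<delta>"] assms by (simp add: algebra_simps)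
  then have "x - of_int m * (1 + \<delta>) \<le> (of_int (m + 1) * (1 + \<delta>) - x) / \<delta>"
    using assms by (simp add: pos_le_divide_eq)
  then show ?thesis
    using assms by (subst sawtooth_eq_min[of \<delta> m]) (auto simp: algebra_simps)
qed

lemma sawtooth_falling:
  assumes \<delta>: "\<delta> > 0" and x: "of_int m * (1 + \<delta>) + 1 \<le> x" "x \<le> of_int (m + 1) * (1 + \<delta>)"
  shows "sawtooth \<delta> x = (of_int (m + 1) * (1 + \<delta>) - x) / \<delta>"
\<comment> \<open>At the right endpoint the floor already jumps to m + 1, so the value comes from
  the start of the next rise.\<close>
proof (cases "x = of_int (m + 1) * (1 + \<delta>)")
  case True
  then show ?thesis using sawtooth_rising[OF \<delta>, of "m + 1" x] by simp
next
  case False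
  have "(x - of_int m * (1 + \<delta>)) * \<delta> \<ge> of_int (m + 1) * (1 + \<delta>) - x"
    using mult_right_mono[of 1 "x - of_int m * (1 + \<delta>)" "1 + \<delta>"] assms by (simp add: algebra_simps)
  then have "x - of_int m * (1 + \<delta>) \<ge> (of_int (m + 1) * (1 + \<delta>) - x) / \<delta>"
    using \<delta> by (simp add: pos_divide_le_eq)
  then show ?thesis
    using False assms by (subst sawtooth_eq_min[of \<delta> m]) auto
qed

text \<open>The floor jumps only at multiples q of the period. Inside a period the function is the
  minimum of two lines; around q it is the maximum of the fall ending at q and the rise starting
  there.\<close>

lemma continuous_sawtooth:
  assumes \<delta>: "\<delta> > 0"
  shows "continuous_on A (sawtooth \<delta>)"
proof -
  have "isCont (sawtooth \<delta>) x" for x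
  proof -
    define m where "m = \<lfloor>x / (1 + \<delta>)\<rfloor>"
    define q where "q = of_int m * (1 + \<delta>)"
    have q1: "of_int (m + 1) * (1 + \<delta>) = q + 1 + \<delta>" by (simp add: q_def algebra_simps)
    have qm: "of_int (m - 1) * (1 + \<delta>) = q - 1 - \<delta>" by (simp add: q_def algebra_simps)
    have m: "q \<le> x" "x < q + 1 + \<delta>"
      using floor_divide_lower[of "1 + \<delta>" x] floor_divide_upper[of "1 + \<delta>" x] \<delta>
      by (auto simp: q_def m_def algebra_simps)
    show ?thesis
    proof (cases "q < x")
      case True
      have "continuous_on {q<..<q + 1 + \<delta>} (\<lambda>x. min (x - q) ((q + 1 + \<delta> - x) / \<delta>))"
        using \<delta> by (intro continuous_intros) auto
      then have "continuous_on {q<..<q + 1 + \<delta>} (sawtooth \<delta>)"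
        by (rule continuous_on_eq)
          (use sawtooth_eq_min[OF \<delta>, of m] q1 in \<open>auto simp: q_def\<close>)
      then show ?thesis using True m by (auto simp: continuous_on_eq_continuous_at)
    next
      case False
      have "continuous_on {q-\<delta><..<q+1} (\<lambda>x. max (x - q) ((q - x) / \<delta>))"
        using \<delta> by (intro continuous_intros) auto
      then have "continuous_on {q-\<delta><..<q+1} (sawtooth \<delta>)"
      proof (rule continuous_on_eq)
        fix x assume x: "x \<in> {q-\<delta><..<q+1}"
        show "max (x - q) ((q - x) / \<delta>) = sawtooth \<delta> x"
        proof (cases "q \<le> x")
          case True
          then have "(q - x) / \<delta> \<le> 0" using \<delta> by (simp add: divide_nonpos_pos)
          then show ?thesis using sawtooth_rising[OF \<delta>, of m x] x True by (simp add: q_def)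
        next
          case False
          then have "(q - x) / \<delta> \<ge> 0" "x - q \<le> 0" using \<delta> by simp_all
          then have "max (x - q) ((q - x) / \<delta>) = (q - x) / \<delta>" by (intro max_absorb2) linarith
          then show ?thesis using sawtooth_falling[OF \<delta>, of "m - 1" x] x False qm by (simp add: q_def)
        qed
      qed
      moreover have "x \<in> {q-\<delta><..<q+1}" using False m \<delta> by auto
      ultimately show ?thesis by (auto simp: continuous_on_eq_continuous_at)
    qed
  qed
  then show ?thesis by (simp add: continuous_at_imp_continuous_on)
qed

lemma admissible_sawtooth:
  assumes \<delta>: "\<delta> > 0" and T: "T = real L * (1 / \<delta> + 1) * \<delta>"
  shows "admissible T (1 / \<delta>) \<delta> (sawtooth \<delta>)"
proof -
  define P where "P = 1 + \<delta>"
  have P: "P > 0" using \<delta> by (simp add: P_def)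
  have "(1 / \<delta> + 1) * \<delta> = 1 + \<delta>" using \<delta> by (simp add: distrib_right)
  then have TP: "T = of_int (int L) * (1 + \<delta>)" by (simp add: T mult.assoc)
  define D where "D = range (\<lambda>m::int. of_int m * P) \<union> range (\<lambda>m::int. of_int m * P + 1)"
  \<comment> \<open>\<open>int_decode\<close> enumerates the falling intervals of all periods,
    positive and negative, by natural numbers.\<close>
  define I where "I k = {of_int (int_decode k) * P + 1 .. of_int (int_decode k) * P + 1 + \<delta>}" for k
  have fin: "finite (range (\<lambda>m::int. of_int m * P + c) \<inter> {a..b})" for a b c
  proof (rule finite_subset)
    show "range (\<lambda>m::int. of_int m * P + c) \<inter> {a..b} \<subseteq> (\<lambda>m. of_int m * P + c) ` {\<lfloor>(a - c) / P\<rfloor>..\<lceil>(b - c) / P\<rceil>}"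
    proof safe
      fix m :: int assume m: "of_int m * P + c \<in> {a..b}"
      then have "(a - c) / P \<le> of_int m" "of_int m \<le> (b - c) / P" using P by (auto simp: field_simps)
      then have "m \<in> {\<lfloor>(a - c) / P\<rfloor>..\<lceil>(b - c) / P\<rceil>}" by (simp; linarith)
      then show "of_int m * P + c \<in> (\<lambda>m. of_int m * P + c) ` {\<lfloor>(a - c) / P\<rfloor>..\<lceil>(b - c) / P\<rceil>}" by blast
    qed
  qed auto
  have D: "finite (D \<inter> {a..b})" for a b
    using fin[of 0 a b] fin[of 1 a b] by (simp add: D_def Int_Un_distrib2)
  have I: "interval_of_length \<delta> (I k)" for k
    unfolding interval_of_length_def I_def by force
  have disj: "i = j" if "x \<in> I i \<inter> I j" for i j x
  proof -
    have "of_int (int_decode i) * P < of_int (int_decode j + 1) * P"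
      "of_int (int_decode j) * P < of_int (int_decode i + 1) * P"
      using that by (auto simp: I_def P_def algebra_simps)
    then have "int_decode i < int_decode j + 1" "int_decode j < int_decode i + 1"
      using P by (simp_all only: mult_less_cancel_right_pos of_int_less_iff)
    then have "int_decode i = int_decode j" by linarith
    then show ?thesis by (simp add: inj_eq inj_int_decode)
  qed
  have der: "(sawtooth \<delta> has_real_derivative (if x \<in> (\<Union>k. I k) then - (1 / \<delta>) else 1)) (at x)"
    if x: "x \<notin> D" for x
  proof -
    define m where "m = \<lfloor>x / P\<rfloor>"
    define q where "q = of_int m * P"
    have q1: "of_int (m + 1) * (1 + \<delta>) = q + 1 + \<delta>" by (simp add: q_def P_def algebra_simps)
    have m: "q \<le> x" "x < q + 1 + \<delta>"
      using floor_divide_lower[of P x] floor_divide_upper[of P x] P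
      by (auto simp: q_def m_def P_def algebra_simps)
    have q: "q < x" "x \<noteq> q + 1" using x m by (auto simp: D_def q_def)
    have UI: "x \<in> (\<Union>k. I k) \<longleftrightarrow> q + 1 < x"
    proof
      assume "q + 1 < x"
      then have "x \<in> I (int_encode m)" using m by (simp add: I_def q_def)
      then show "x \<in> (\<Union>k. I k)" by blast
    next
      assume "x \<in> (\<Union>k. I k)"
      then obtain k where k: "x \<in> I k" by blast
      define j where "j = int_decode k"
      have j: "of_int j * P + 1 \<le> x" "x \<le> of_int (j + 1) * P"
        using k by (auto simp: I_def j_def P_def algebra_simps)
      have "of_int m * P < of_int (j + 1) * P" using q(1) j(2) by (simp add: q_def)
      moreover have "of_int j * P < of_int (m + 1) * P" using j(1) m(2) by (simp add: q_def P_def algebra_simps)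
      ultimately have "m < j + 1" "j < m + 1" using P by (simp_all only: mult_less_cancel_right_pos of_int_less_iff)
      then have "m = j" by linarith
      then show "q + 1 < x" using j q by (simp add: q_def)
    qed
    show ?thesis
    proof (cases "q + 1 < x")
      case True
      have "((\<lambda>x. (q + 1 + \<delta> - x) / \<delta>) has_real_derivative - (1 / \<delta>)) (at x)"
        using \<delta> by (auto intro!: derivative_eq_intros)
      then have "(sawtooth \<delta> has_real_derivative - (1 / \<delta>)) (at x)"
        by (rule has_field_derivative_transform_within_open[where S="{q+1<..<q+1+\<delta>}"])
          (use True m sawtooth_falling[OF \<delta>, of m] q1 in \<open>auto simp: q_def P_def\<close>)
      then show ?thesis using True UI by simp
    next
      case False
      have "((\<lambda>x. x - q) has_real_derivative 1) (at x)"
        by (auto intro!: derivative_eq_intros)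
      then have "(sawtooth \<delta> has_real_derivative 1) (at x)"
        by (rule has_field_derivative_transform_within_open[where S="{q<..<q+1}"])
          (use False q m sawtooth_rising[OF \<delta>, of m] in \<open>auto simp: q_def P_def\<close>)
      then show ?thesis using False UI by simp
    qed
  qed
  show ?thesis
    unfolding admissible_def TP
    by (intro conjI exI[of _ D] exI[of _ I] allI impI continuous_sawtooth \<delta> sawtooth_shift D I der)
      (use disj in blast)+
qed

text \<open>Equality in the lower bound: the gaps have length 1, so for h \<le> 1 the interval
  [x, x + h] cannot overlap two falling intervals in positive length and no cross terms are lost.
  One period suffices, and starting it at 1 - h puts the full support [1 - h, 1 + \<delta>] of the
  overlap with [1, 1 + \<delta>] inside it.\<close>

lemma increment_sq_sawtooth:
  assumes \<delta>: "\<delta> > 0" and h: "0 < h" "h \<le> 1"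
    and L: "L \<ge> 1" and T: "T = real L * (1 / \<delta> + 1) * \<delta>"
  shows "increment_sq T (sawtooth \<delta>) h = (1 + 1 / \<delta>)\<^sup>2 * real L * overlap_sq \<delta> h - T * h\<^sup>2"
proof -
  define P where "P = 1 + \<delta>"
  have P: "P > 0" using \<delta> by (simp add: P_def)
  define U where "U = (\<lambda>x. (x - sawtooth \<delta> x) / (1 + 1 / \<delta>))"
  let ?d = "\<lambda>x. (sawtooth \<delta> (x + h) - sawtooth \<delta> x)\<^sup>2"
  have per: "sawtooth \<delta> (x + P) = sawtooth \<delta> x" for x
    using sawtooth_shift[OF \<delta>, of x 1] by (simp add: P_def)
  have cont: "continuous_on UNIV (sawtooth \<delta>)" by (rule continuous_sawtooth[OF \<delta>])
  have "(1 / \<delta> + 1) * \<delta> = P" using \<delta> by (simp add: P_def distrib_right)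
  then have TP: "T = real L * P" by (simp add: T mult.assoc)
  \<comment> \<open>Up to 2 + \<delta>, where the second fall starts, only the fall on
    [1, 1 + \<delta>] is seen.\<close>
  have U: "U x = ramp \<delta> 1 x" if "0 \<le> x" "x \<le> 2 + \<delta>" for x
  proof -
    consider "x \<le> 1" | "1 \<le> x" "x \<le> 1 + \<delta>" | "1 + \<delta> \<le> x" by linarith
    then show ?thesis
    proof cases
      case 1
      then show ?thesis using sawtooth_rising[OF \<delta>, of 0 x] that \<delta> by (simp add: U_def ramp_def)
    next
      case 2
      then have "x - sawtooth \<delta> x = (x - 1) * (1 + 1 / \<delta>)"
        using sawtooth_falling[OF \<delta>, of 0 x] \<delta> by (simp add: field_simps)
      moreover have "1 + 1 / \<delta> > 0" using \<delta> by (simp add: add_pos_pos)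
      ultimately show ?thesis using 2 by (simp add: U_def ramp_def)
    next
      case 3
      then have "x - sawtooth \<delta> x = \<delta> * (1 + 1 / \<delta>)"
        using sawtooth_rising[OF \<delta>, of 1 x] that \<delta> by (simp add: distrib_left)
      moreover have "1 + 1 / \<delta> > 0" using \<delta> by (simp add: add_pos_pos)
      ultimately show ?thesis using 3 by (simp add: U_def ramp_def)
    qed
  qed
  let ?r = "\<lambda>x. (ramp \<delta> 1 (x + h) - ramp \<delta> 1 x)\<^sup>2"
  have "((\<lambda>x. 0) has_integral 0) {1 + \<delta>..1 - h + P}" by simp
  then have "(?r has_integral 0) {1 + \<delta>..1 - h + P}"
    by (rule has_integral_eq[rotated]) (use h \<delta> in \<open>auto simp: ramp_def P_def\<close>)
  with ramp_increment_sq_integral[OF h(1) \<delta>, of 1]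
  have "(?r has_integral overlap_sq \<delta> h + 0) {1 - h..1 - h + P}"
    by (rule has_integral_combine[rotated 2]) (use h \<delta> in \<open>auto simp: P_def\<close>)
  then have "((\<lambda>x. (U (x + h) - U x)\<^sup>2) has_integral overlap_sq \<delta> h) {1 - h..1 - h + P}"
    by (subst has_integral_cong[where g="?r"]) (use h \<delta> in \<open>auto simp: U P_def\<close>)
  then have "increment_sq P (sawtooth \<delta>) h + P * h\<^sup>2 = (1 + 1 / \<delta>)\<^sup>2 * overlap_sq \<delta> h"
    using fall_increment_integral[OF cont per less_imp_le[OF P], of "1 / \<delta>" "1 - h" 1 h] \<delta>
    by (simp add: U_def integral_unique)
  moreover have "increment_sq T (sawtooth \<delta>) h = real L * increment_sq P (sawtooth \<delta>) h"
  proof -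
    have "sawtooth \<delta> (x + P + h) = sawtooth \<delta> (x + h)" for x
      using per[of "x + h"] by (simp add: add_ac)
    then show ?thesis
      using integral_periods[of ?d P 0 L 0] continuous_on_increment_sq[OF cont] P
      by (simp add: increment_sq_def TP per)
  qed
  ultimately have "increment_sq T (sawtooth \<delta>) h = real L * ((1 + 1 / \<delta>)\<^sup>2 * overlap_sq \<delta> h - P * h\<^sup>2)"
    by (metis add_diff_cancel_right')
  also have "\<dots> = (1 + 1 / \<delta>)\<^sup>2 * real L * overlap_sq \<delta> h - T * h\<^sup>2"
    unfolding TP right_diff_distrib by (simp only: mult_ac)
  finally show ?thesis .
qed

text \<open>The values lie in [0, 1], so no increment exceeds 1. This crude bound serves for h >
  1.\<close>

lemma increment_sq_sawtooth_le:
  assumes \<delta>: "\<delta> > 0" and T: "T \<ge> 0"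
  shows "increment_sq T (sawtooth \<delta>) h \<le> T"
proof -
  have "increment_sq T (sawtooth \<delta>) h \<le> integral {0..T} (\<lambda>x. 1)"
    unfolding increment_sq_def
  proof (rule integral_le)
    fix x
    have "\<bar>sawtooth \<delta> (x + h) - sawtooth \<delta> x\<bar> \<le> 1"
      using sawtooth_nonneg[OF \<delta>, of x] sawtooth_le_1[OF \<delta>, of x]
        sawtooth_nonneg[OF \<delta>, of "x+h"] sawtooth_le_1[OF \<delta>, of "x+h"]
      unfolding abs_le_iff by simp
    then show "(sawtooth \<delta> (x + h) - sawtooth \<delta> x)\<^sup>2 \<le> 1" by (simp add: abs_square_le_1)
  qed (auto intro!: integrable_continuous_real continuous_on_increment_sq continuous_sawtooth \<delta>)
  then show ?thesis using T by simp
qed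

section \<open>Asymptotics of the sawtooth energy\<close>

text \<open>The mean over a period of the squared increments of the sawtooth, for \<open>0 < h \<le> 1\<close>.\<close>

definition profile :: "real \<Rightarrow> real \<Rightarrow> real" where
  "profile \<delta> h = (1 + 1 / \<delta>) / \<delta> * overlap_sq \<delta> h - h\<^sup>2"

definition profile_energy :: "real \<Rightarrow> real \<Rightarrow> real" where
  "profile_energy s \<delta> = integral {0..1} (\<lambda>h. profile \<delta> h / h powr (1 + 2 * s))"

lemma has_integral_powr_Icc:
  fixes p q :: real
  assumes "0 < a" "a \<le> b" "p + 1 = q" "q \<noteq> 0"
  shows "((\<lambda>x. x powr p) has_integral (b powr q - a powr q) / q) {a..b}"
proof -
  have p: "p = q - 1" using assms by simp
  have "((\<lambda>x. x powr p) has_integral b powr q / q - a powr q / q) {a..b}"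
  proof (rule fundamental_theorem_of_calculus[OF assms(2)])
    fix x assume "x \<in> {a..b}"
    then have "((\<lambda>x. x powr q / q) has_real_derivative x powr p) (at x within {a..b})"
      using assms(1,4) unfolding p by (auto intro!: derivative_eq_intros)
    then show "((\<lambda>x. x powr q / q) has_vector_derivative x powr p) (at x within {a..b})"
      by (simp add: has_real_derivative_iff_has_vector_derivative)
  qed
  then show ?thesis by (simp add: diff_divide_distrib)
qed

lemma has_integral_inverse_Icc:
  assumes "0 < a" "a \<le> b"
  shows "((\<lambda>x. x powr (-1)) has_integral ln (b / a)) {a..b :: real}"
proof -
  have "((\<lambda>x. x powr (-1)) has_integral ln b - ln a) {a..b}"
  proof (rule fundamental_theorem_of_calculus[OF assms(2)])
    fix x assume "x \<in> {a..b}"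
    then have "(ln has_real_derivative x powr (-1)) (at x within {a..b})"
      using assms by (auto intro!: derivative_eq_intros simp: powr_minus field_simps)
    then show "(ln has_vector_derivative x powr (-1)) (at x within {a..b})"
      by (simp add: has_real_derivative_iff_has_vector_derivative)
  qed
  then show ?thesis using assms by (simp add: ln_div)
qed

text \<open>The integral of \<open>h powr (- 2 * s)\<close> over \<open>[\<delta>, 1]\<close>.\<close>

definition tail_energy :: "real \<Rightarrow> real \<Rightarrow> real" where
  "tail_energy s \<delta> = (if s = 1/2 then ln (1 / \<delta>) else (\<delta> powr (1 - 2 * s) - 1) / (2 * s - 1))"

text \<open>The interval is split at h = \<delta>, where min and max in \<open>overlap_sq\<close>
  change roles. On each side the profile is a polynomial in h, so only powers are integrated; the
  term linear in h on [\<delta>, 1] yields \<open>tail_energy\<close>, a logarithm exactly when s =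
  1/2.\<close>

lemma profile_has_integral:
  assumes s: "1/2 \<le> s" "s < 1" and \<delta>: "0 < \<delta>" "\<delta> < 1"
  defines "w \<equiv> \<delta> powr (1 - 2 * s)"
  shows "((\<lambda>h. profile \<delta> h / h powr (1 + 2 * s)) has_integral
    w / (2 - 2 * s) - (1 + \<delta>) * w / (3 * (3 - 2 * s)) + (1 + \<delta>) * tail_energy s \<delta>
     - (1 + \<delta>) * (w - \<delta>) / (6 * s) - (1 - w * \<delta>) / (2 - 2 * s)) {0..1}"
proof -
  let ?f = "\<lambda>h. profile \<delta> h / h powr (1 + 2 * s)"
  have pw: "x powr (1 - 2 * s) = x\<^sup>2 / x powr (1 + 2 * s)"
    "x powr (2 - 2 * s) = x^3 / x powr (1 + 2 * s)"
    "x powr (- 2 * s) = x / x powr (1 + 2 * s)"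
    "x powr (-1 - 2 * s) = 1 / x powr (1 + 2 * s)" if "x > 0" for x
    using that powr_diff[of x 2 "1 + 2 * s"] powr_diff[of x 3 "1 + 2 * s"]
      powr_diff[of x 1 "1 + 2 * s"] powr_diff[of x 0 "1 + 2 * s"]
    by (simp_all add: algebra_simps)
  have w: "\<delta> powr (2 - 2 * s) = w * \<delta>" "\<delta> powr (3 - 2 * s) = w * \<delta>\<^sup>2" "\<delta> powr (- 2 * s) = w / \<delta>"
    using \<delta> powr_add[of \<delta> "1 - 2 * s" 1] powr_add[of \<delta> "1 - 2 * s" 2] powr_diff[of \<delta> "1 - 2 * s" 1]
    by (simp_all add: w_def algebra_simps)
  have near: "(?f has_integral 1 / \<delta> * (\<delta> powr (2 - 2 * s) / (2 - 2 * s))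
      - (1 + 1 / \<delta>) / (3 * \<delta>) * (\<delta> powr (3 - 2 * s) / (3 - 2 * s))) {0..\<delta>}"
  proof (rule has_integral_eq)
    have "((\<lambda>x. x powr (1 - 2 * s)) has_integral \<delta> powr (2 - 2 * s) / (2 - 2 * s)) {0..\<delta>}"
      "((\<lambda>x. x powr (2 - 2 * s)) has_integral \<delta> powr (3 - 2 * s) / (3 - 2 * s)) {0..\<delta>}"
      using has_integral_powr_from_0[of "1 - 2 * s" \<delta>] has_integral_powr_from_0[of "2 - 2 * s" \<delta>] s \<delta>
      by simp_all
    then show "((\<lambda>h. 1 / \<delta> * h powr (1 - 2 * s) - (1 + 1 / \<delta>) / (3 * \<delta>) * h powr (2 - 2 * s)) has_integral
      1 / \<delta> * (\<delta> powr (2 - 2 * s) / (2 - 2 * s))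
      - (1 + 1 / \<delta>) / (3 * \<delta>) * (\<delta> powr (3 - 2 * s) / (3 - 2 * s))) {0..\<delta>}"
      by (intro has_integral_diff has_integral_mult_right)
    fix h assume h: "h \<in> {0..\<delta>}"
    show "1 / \<delta> * h powr (1 - 2 * s) - (1 + 1 / \<delta>) / (3 * \<delta>) * h powr (2 - 2 * s) = ?f h"
    \<comment> \<open>At h = 0 both sides are 0, as \<open>0 powr p = 0\<close> and division by zero
      gives 0.\<close>
    proof (cases "h = 0")
      case False
      then have pos: "h > 0" using h by simp
      have "profile \<delta> h = 1 / \<delta> * h\<^sup>2 - (1 + 1 / \<delta>) / (3 * \<delta>) * h^3"
        using h \<delta> by (simp add: profile_def overlap_sq_def field_simps)
      then show ?thesis using pos by (simp only: pw) (simp add: diff_divide_distrib)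
    qed simp
  qed
  have far: "(?f has_integral (1 + \<delta>) * tail_energy s \<delta>
      - (1 + \<delta>) * \<delta> / 3 * ((1 - \<delta> powr (- 2 * s)) / (- 2 * s))
      - (1 - \<delta> powr (2 - 2 * s)) / (2 - 2 * s)) {\<delta>..1}"
  proof (rule has_integral_eq)
    have "((\<lambda>x. x powr (- 2 * s)) has_integral tail_energy s \<delta>) {\<delta>..1}"
    proof (cases "s = 1/2")
      case True
      then have "- 2 * s = -1" "tail_energy s \<delta> = ln (1 / \<delta>)" by (simp_all add: tail_energy_def)
      then show ?thesis using has_integral_inverse_Icc[of \<delta> 1] \<delta> by (simp only:)
    next
      case False
      have "((\<lambda>x. x powr (- 2 * s)) has_integral (1 powr (1 - 2 * s) - \<delta> powr (1 - 2 * s)) / (1 - 2 * s)) {\<delta>..1}"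
        by (rule has_integral_powr_Icc) (use \<delta> False in auto)
      moreover have "(1 - \<delta> powr (1 - 2 * s)) / (1 - 2 * s) = tail_energy s \<delta>"
        using False minus_divide_divide[of "\<delta> powr (1 - 2 * s) - 1" "2 * s - 1"]
        unfolding tail_energy_def minus_diff_eq by (simp only: if_False)
      ultimately show ?thesis by (simp only: powr_one_eq_one)
    qed
    moreover have "((\<lambda>x. x powr (-1 - 2 * s)) has_integral (1 powr (- 2 * s) - \<delta> powr (- 2 * s)) / (- 2 * s)) {\<delta>..1}"
      by (rule has_integral_powr_Icc) (use \<delta> s in auto)
    moreover have "((\<lambda>x. x powr (1 - 2 * s)) has_integral (1 powr (2 - 2 * s) - \<delta> powr (2 - 2 * s)) / (2 - 2 * s)) {\<delta>..1}"
      by (rule has_integral_powr_Icc) (use \<delta> s in auto)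
    ultimately show "((\<lambda>h. (1 + \<delta>) * h powr (- 2 * s) - (1 + \<delta>) * \<delta> / 3 * h powr (-1 - 2 * s) - h powr (1 - 2 * s)) has_integral
      (1 + \<delta>) * tail_energy s \<delta> - (1 + \<delta>) * \<delta> / 3 * ((1 - \<delta> powr (- 2 * s)) / (- 2 * s))
      - (1 - \<delta> powr (2 - 2 * s)) / (2 - 2 * s)) {\<delta>..1}"
      unfolding powr_one_eq_one by (intro has_integral_diff has_integral_mult_right)
    fix h assume h: "h \<in> {\<delta>..1}"
    then have pos: "h > 0" using \<delta> by simp
    have "(1 + 1 / \<delta>) / \<delta> * (\<delta>\<^sup>2 * h - \<delta>^3 / 3) = (1 + \<delta>) * (h - \<delta> / 3)"
      using \<delta> by (simp add: field_simps power2_eq_square power3_eq_cube)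
    then have "profile \<delta> h = (1 + \<delta>) * h - (1 + \<delta>) * \<delta> / 3 - h\<^sup>2"
      using h \<delta> by (simp add: profile_def overlap_sq_def right_diff_distrib)
    then show "(1 + \<delta>) * h powr (- 2 * s) - (1 + \<delta>) * \<delta> / 3 * h powr (-1 - 2 * s) - h powr (1 - 2 * s) = ?f h"
      using pos by (simp only: pw) (simp add: diff_divide_distrib)
  qed
  have "w / (2 - 2 * s) - (1 + \<delta>) * w / (3 * (3 - 2 * s)) + (1 + \<delta>) * tail_energy s \<delta>
     - (1 + \<delta>) * (w - \<delta>) / (6 * s) - (1 - w * \<delta>) / (2 - 2 * s)
    = (1 / \<delta> * (\<delta> powr (2 - 2 * s) / (2 - 2 * s))
      - (1 + 1 / \<delta>) / (3 * \<delta>) * (\<delta> powr (3 - 2 * s) / (3 - 2 * s)))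
      + ((1 + \<delta>) * tail_energy s \<delta> - (1 + \<delta>) * \<delta> / 3 * ((1 - \<delta> powr (- 2 * s)) / (- 2 * s))
      - (1 - \<delta> powr (2 - 2 * s)) / (2 - 2 * s))"
  proof -
    have e1: "(1 + 1 / \<delta>) / (3 * \<delta>) * (w * \<delta>\<^sup>2 / (3 - 2 * s)) = (1 + \<delta>) * w / (3 * (3 - 2 * s))"
    proof -
      have "(1 + 1 / \<delta>) / (3 * \<delta>) * \<delta>\<^sup>2 = (1 + \<delta>) / 3"
        using \<delta> by (simp add: field_simps power2_eq_square)
      then have "(1 + 1 / \<delta>) / (3 * \<delta>) * \<delta>\<^sup>2 * (w / (3 - 2 * s)) = (1 + \<delta>) / 3 * (w / (3 - 2 * s))"
        by (rule arg_cong)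
      then show ?thesis by (simp add: mult_ac)
    qed
    have e2: "(1 + \<delta>) * \<delta> / 3 * ((1 - w / \<delta>) / (- 2 * s)) = (1 + \<delta>) * (w - \<delta>) / (6 * s)"
    proof -
      have eq: "\<delta> * (1 - w / \<delta>) = - (w - \<delta>)" using \<delta> by (simp add: right_diff_distrib)
      have "(1 + \<delta>) * \<delta> / 3 * ((1 - w / \<delta>) / (- 2 * s)) = (1 + \<delta>) / 3 * (\<delta> * (1 - w / \<delta>) / (- 2 * s))"
        by (simp only: times_divide_eq_left times_divide_eq_right mult.assoc)
      also have "\<dots> = (1 + \<delta>) * (w - \<delta>) / (6 * s)"
        unfolding eq mult_minus_left minus_divide_divide by simp
      finally show ?thesis .
    qed
    have e3: "1 / \<delta> * (w * \<delta> / (2 - 2 * s)) = w / (2 - 2 * s)" using \<delta> by simp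
    show ?thesis unfolding w e1 e2 e3 by (simp only: add_diff_eq)
  qed
  then show ?thesis using has_integral_combine[OF _ _ near far] \<delta> by (metis less_imp_le)
qed

text \<open>Normalised by T, the lower bound of \<open>increment_sq_ge\<close> loses its dependence
  on L and becomes the profile.\<close>

lemma sawtooth_profile:
  assumes \<delta>: "\<delta> > 0" and L: "L \<ge> 1" and T: "T = real L * (1 / \<delta> + 1) * \<delta>"
  shows "((1 + 1 / \<delta>)\<^sup>2 * real L * overlap_sq \<delta> h - T * h\<^sup>2) / T = profile \<delta> h"
proof -
  have pos: "1 + 1 / \<delta> > 0" using \<delta> by (simp add: add_pos_pos)
  then have "T \<noteq> 0" using T L \<delta> by simp
  moreover have "(1 + 1 / \<delta>)\<^sup>2 * real L / T = (1 + 1 / \<delta>) / \<delta>"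
    using L \<delta> pos unfolding T by (simp add: power2_eq_square add.commute)
  then have "(1 + 1 / \<delta>)\<^sup>2 * real L * overlap_sq \<delta> h / T = (1 + 1 / \<delta>) / \<delta> * overlap_sq \<delta> h"
    by (metis times_divide_eq_left)
  ultimately show ?thesis by (simp add: profile_def diff_divide_distrib)
qed

section \<open>Two-sided bounds for the minimal energy\<close>

context
  fixes s \<delta> T :: real and L :: nat
  assumes s: "1/2 \<le> s" "s < 1" and \<delta>: "0 < \<delta>" "\<delta> < 1"
    and L: "L \<ge> 1" and T: "T = real L * (1 / \<delta> + 1) * \<delta>"
begin

lemma period_pos: "T > 0"
  using T L \<delta> by (simp add: add_pos_pos)

lemma profile_eq_sawtooth:
  assumes "0 < h" "h \<le> 1"
  shows "profile \<delta> h = increment_sq T (sawtooth \<delta>) h / T"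
  using increment_sq_sawtooth[OF \<delta>(1) assms L T] sawtooth_profile[OF \<delta>(1) L T] by simp

text \<open>Not read off the formula: for h \<le> 1 the profile is a mean of squares, namely that of
  the sawtooth.\<close>

lemma profile_nonneg:
  assumes "0 < h" "h \<le> 1"
  shows "profile \<delta> h \<ge> 0"
proof -
  have "increment_sq T (sawtooth \<delta>) h \<ge> 0"
    unfolding increment_sq_def
    by (rule integral_nonneg)
      (auto intro!: integrable_continuous_real continuous_on_increment_sq continuous_sawtooth \<delta>)
  then show ?thesis using profile_eq_sawtooth[OF assms] period_pos by simp
qed

lemma profile_integrand_nonneg:
  assumes "h \<in> {0..1}"
  shows "profile \<delta> h / h powr (1 + 2 * s) \<ge> 0"
proof (cases "h = 0")
  case False
  then show ?thesis using profile_nonneg[of h] assms by simp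
qed simp

lemma profile_energy_has_integral:
  "((\<lambda>h. profile \<delta> h / h powr (1 + 2 * s)) has_integral profile_energy s \<delta>) {0..1}"
  unfolding profile_energy_def
  using profile_has_integral[OF s \<delta>] by (rule integrable_integral[OF has_integral_integrable])

lemma profile_energy_nonneg: "profile_energy s \<delta> \<ge> 0"
  using profile_energy_has_integral by (rule has_integral_nonneg) (rule profile_integrand_nonneg)

lemma profile_energy_nn_integral:
  "(\<integral>\<^sup>+h. ennreal (profile \<delta> h / h powr (1 + 2 * s)) * indicator {0..1} h \<partial>lborel) = ennreal (profile_energy s \<delta>)"
  using profile_integrand_nonneg profile_energy_has_integral by (rule nn_integral_has_integral_lebesgue')

text \<open>Discard the increments with h > 1 and apply \<open>increment_sq_ge\<close> for each
  remaining h.\<close>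

lemma energy_ge_profile_energy:
  assumes adm: "admissible T (1 / \<delta>) \<delta> u"
  shows "energy T s u \<ge> ennreal (profile_energy s \<delta>)"
proof -
  have cont: "continuous_on UNIV u" and per: "\<And>x. u (x + T) = u x"
    using adm unfolding admissible_def by auto
  have T': "T = real L * (1 + 1 / \<delta>) * \<delta>" using T by (simp add: add.commute)
  show ?thesis
    unfolding profile_energy_nn_integral[symmetric] energy_eq_increment_integral[OF cont per period_pos]
  proof (rule nn_integral_mono)
    fix h :: real
    have "profile \<delta> h / h powr (1 + 2 * s) \<le> increment_sq T u h / T / h powr (1 + 2 * s)" if "h > 0"
    proof (rule divide_right_mono)
      have "profile \<delta> h = ((1 + 1 / \<delta>)\<^sup>2 * real L * overlap_sq \<delta> h - T * h\<^sup>2) / T"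
        using sawtooth_profile[OF \<delta>(1) L T] by simp
      also have "\<dots> \<le> increment_sq T u h / T"
        using increment_sq_ge[OF adm \<delta>(1) _ that L T'] \<delta> period_pos by (intro divide_right_mono) auto
      finally show "profile \<delta> h \<le> increment_sq T u h / T" .
    qed simp
    \<comment> \<open>At h = 0 only the left indicator is 1, but the quotient there is 0 by the
      convention for division by zero.\<close>
    then show "ennreal (profile \<delta> h / h powr (1 + 2 * s)) * indicator {0..1} h
      \<le> ennreal (increment_sq T u h / T / h powr (1 + 2 * s)) * indicator {0<..} h"
      by (cases "h = 0") (auto simp: indicator_def intro!: ennreal_leI)
  qed
qed

text \<open>The profile is exact for h \<le> 1. For h > 1 the mean squared increment is at most 1,
  and the integral of h powr (-1 - 2 * s) over [1, \<infinity>) is 1 / (2 s).\<close>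

lemma energy_sawtooth_le:
  "energy T s (sawtooth \<delta>) \<le> ennreal (profile_energy s \<delta> + 1 / (2 * s))"
proof -
  have adm: "admissible T (1 / \<delta>) \<delta> (sawtooth \<delta>)" by (rule admissible_sawtooth[OF \<delta>(1) T])
  have cont: "continuous_on UNIV (sawtooth \<delta>)" and per: "\<And>x. sawtooth \<delta> (x + T) = sawtooth \<delta> x"
    using adm unfolding admissible_def by auto
  have [measurable]: "profile \<delta> \<in> borel_measurable borel"
    unfolding profile_def overlap_sq_def by measurable
  have "((\<lambda>h. h powr (-1 - 2 * s)) has_integral 1 / (2 * s)) {1..}"
    using has_integral_powr_to_inf[of "-1 - 2 * s" 1] s by simp
  then have tail: "(\<integral>\<^sup>+h. ennreal (h powr (-1 - 2 * s)) * indicator {1..} h \<partial>lborel) = ennreal (1 / (2 * s))"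
    by (rule nn_integral_has_integral_lebesgue'[rotated]) simp
  have "energy T s (sawtooth \<delta>) \<le> (\<integral>\<^sup>+h. ennreal (profile \<delta> h / h powr (1 + 2 * s)) * indicator {0..1} h
      + ennreal (h powr (-1 - 2 * s)) * indicator {1..} h \<partial>lborel)"
    unfolding energy_eq_increment_integral[OF cont per period_pos]
  proof (rule nn_integral_mono)
    fix h :: real
    consider "h \<le> 0" | "0 < h" "h \<le> 1" | "1 < h" by linarith
    then show "ennreal (increment_sq T (sawtooth \<delta>) h / T / h powr (1 + 2 * s)) * indicator {0<..} h
      \<le> ennreal (profile \<delta> h / h powr (1 + 2 * s)) * indicator {0..1} h
       + ennreal (h powr (-1 - 2 * s)) * indicator {1..} h"
    proof cases
      case 2
      then show ?thesis by (simp add: profile_eq_sawtooth)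
    next
      case 3
      have "increment_sq T (sawtooth \<delta>) h / T / h powr (1 + 2 * s) \<le> 1 / h powr (1 + 2 * s)"
        using increment_sq_sawtooth_le[OF \<delta>(1) less_imp_le[OF period_pos], of h] period_pos
        by (intro divide_right_mono) auto
      also have "\<dots> = h powr (-1 - 2 * s)"
        using powr_minus_divide[of h "1 + 2 * s"] by simp
      finally show ?thesis using 3 by (simp add: ennreal_leI)
    qed simp
  qed
  also have "\<dots> = ennreal (profile_energy s \<delta>) + ennreal (1 / (2 * s))"
    unfolding profile_energy_nn_integral[symmetric] tail[symmetric]
    by (rule nn_integral_add) measurable
  also have "\<dots> = ennreal (profile_energy s \<delta> + 1 / (2 * s))"
    using profile_energy_nonneg s by (simp add: ennreal_plus)
  finally show ?thesis .
qed

lemma minimizer_energy_bounds: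
  assumes min: "is_minimizer T (1 / \<delta>) \<delta> s u"
  shows "profile_energy s \<delta> \<le> enn2real (energy T s u)"
    and "enn2real (energy T s u) \<le> profile_energy s \<delta> + 1 / (2 * s)"
proof -
  have nonneg: "profile_energy s \<delta> + 1 / (2 * s) \<ge> 0" using profile_energy_nonneg s by simp
  have "energy T s u \<le> energy T s (sawtooth \<delta>)"
    using min admissible_sawtooth[OF \<delta>(1) T] unfolding is_minimizer_def by blast
  with energy_sawtooth_le have upper: "energy T s u \<le> ennreal (profile_energy s \<delta> + 1 / (2 * s))"
    by (rule order_trans[rotated])
  then show "enn2real (energy T s u) \<le> profile_energy s \<delta> + 1 / (2 * s)"
    using nonneg by (simp add: enn2real_leI)
  have "ennreal (profile_energy s \<delta>) \<le> energy T s u"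
    using min energy_ge_profile_energy unfolding is_minimizer_def by blast
  \<comment> \<open>Finiteness matters because \<open>enn2real\<close> sends infinity to 0 and is
    monotone only below it.\<close>
  moreover have "energy T s u < top"
    using upper by (rule order_le_less_trans) simp
  ultimately have "enn2real (ennreal (profile_energy s \<delta>)) \<le> enn2real (energy T s u)"
    by (rule enn2real_mono)
  then show "profile_energy s \<delta> \<le> enn2real (energy T s u)"
    using profile_energy_nonneg by simp
qed

end

section \<open>Comparison of the profile energy with the scale \<sigma>\<close>

definition scale :: "real \<Rightarrow> real \<Rightarrow> real" where
  "scale s \<delta> = (if s = 1/2 then ln (1 / \<delta>)
     else \<delta> powr (1 - 2 * s) / (2 * s * (1 - s) * (2 * s - 1) * (3 - 2 * s)))"

lemma filterlim_scale_at_top: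
  fixes \<delta> :: "nat \<Rightarrow> real"
  assumes s: "1/2 \<le> s" "s < 1" and \<delta>: "filterlim \<delta> (at_right 0) sequentially"
  shows "filterlim (\<lambda>n. scale s (\<delta> n)) at_top sequentially"
proof (cases "s = 1/2")
  case True
  have "filterlim (\<lambda>n. inverse (\<delta> n)) at_top sequentially"
    using filterlim_compose[OF filterlim_inverse_at_top_right \<delta>] .
  then have "filterlim (\<lambda>n. ln (1 / \<delta> n)) at_top sequentially"
    using filterlim_compose[OF ln_at_top] by (simp add: inverse_eq_divide)
  then show ?thesis using True by (simp add: scale_def)
next
  case False
  define c where "c = 2 * s * (1 - s) * (2 * s - 1) * (3 - 2 * s)"
  have c: "c > 0" using s False by (simp add: c_def)
  have lim: "\<delta> \<longlonglongrightarrow> 0" and ev: "eventually (\<lambda>n. \<delta> n > 0) sequentially"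
    using \<delta> by (auto simp: filterlim_at elim: eventually_mono)
  have "(\<lambda>n. \<delta> n powr (2 * s - 1)) \<longlonglongrightarrow> 0"
    by (rule tendsto_zero_powrI[OF lim tendsto_const]) (use s False ev in \<open>auto elim: eventually_mono\<close>)
  then have "(\<lambda>n. c * \<delta> n powr (2 * s - 1)) \<longlonglongrightarrow> 0"
    by (rule tendsto_mult_right_zero)
  moreover have "eventually (\<lambda>n. 0 < c * \<delta> n powr (2 * s - 1)) sequentially"
    using ev by eventually_elim (use c in simp)
  ultimately have "filterlim (\<lambda>n. inverse (c * \<delta> n powr (2 * s - 1))) at_top sequentially"
    by (rule filterlim_inverse_at_top)
  moreover have "inverse (c * \<delta> n powr (2 * s - 1)) = scale s (\<delta> n)" for n
  proof -
    have "scale s (\<delta> n) = \<delta> n powr (1 - 2 * s) / c" using False by (simp add: scale_def c_def)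
    also have "\<delta> n powr (1 - 2 * s) = inverse (\<delta> n powr (2 * s - 1))"
      using powr_minus[of "\<delta> n" "2 * s - 1"] unfolding minus_diff_eq .
    finally show ?thesis by (simp only: divide_inverse inverse_mult_distrib mult.commute)
  qed
  ultimately show ?thesis by simp
qed

text \<open>For s = 1/2 every term of the explicit integral except (1 + \<delta>) ln (1 / \<delta>)
  is bounded. For s > 1/2 several terms are of the order \<delta> powr (1 - 2 * s), and their
  coefficients add up to the constant in the scale.\<close>

lemma profile_energy_asymp:
  fixes \<delta> :: "nat \<Rightarrow> real"
  assumes s: "1/2 \<le> s" "s < 1" and \<delta>: "filterlim \<delta> (at_right 0) sequentially"
  shows "(\<lambda>n. profile_energy s (\<delta> n) / scale s (\<delta> n)) \<longlonglongrightarrow> 1"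
proof -
  have lim: "\<delta> \<longlonglongrightarrow> 0" and ev0: "eventually (\<lambda>n. \<delta> n > 0) sequentially"
    using \<delta> by (auto simp: filterlim_at elim: eventually_mono)
  have ev1: "eventually (\<lambda>n. \<delta> n < 1) sequentially"
    using lim by (rule order_tendstoD) simp
  have ev: "eventually (\<lambda>n. 0 < \<delta> n \<and> \<delta> n < 1) sequentially"
    using ev0 ev1 by eventually_elim simp
  have scale: "filterlim (\<lambda>n. scale s (\<delta> n)) at_top sequentially"
    by (rule filterlim_scale_at_top[OF s \<delta>])
  have ev2: "eventually (\<lambda>n. scale s (\<delta> n) > 0) sequentially"
    using scale by (simp add: filterlim_at_top_dense)
  have J: "profile_energy s d = d powr (1 - 2 * s) / (2 - 2 * s) - (1 + d) * d powr (1 - 2 * s) / (3 * (3 - 2 * s))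
      + (1 + d) * tail_energy s d - (1 + d) * (d powr (1 - 2 * s) - d) / (6 * s)
      - (1 - d powr (1 - 2 * s) * d) / (2 - 2 * s)" if "0 < d \<and> d < 1" for d
    unfolding profile_energy_def using profile_has_integral[OF s, of d] that by (simp add: integral_unique)
  show ?thesis
  proof (cases "s = 1/2")
    case True
    have half: "profile_energy s d / scale s d
      = (1 - (1 + d) / 6 - (1 + d) * (1 - d) / 3 - (1 - d)) / scale s d + (1 + d)"
      if "0 < d \<and> d < 1" "scale s d > 0" for d
      using that J[of d] unfolding True by (simp add: scale_def tail_energy_def add_divide_distrib diff_divide_distrib)
    have "(\<lambda>n. 1 - (1 + \<delta> n) / 6 - (1 + \<delta> n) * (1 - \<delta> n) / 3 - (1 - \<delta> n))
        \<longlonglongrightarrow> 1 - (1 + 0) / 6 - (1 + 0) * (1 - 0) / 3 - (1 - 0)"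
      by (intro tendsto_intros lim) auto
    then have "(\<lambda>n. (1 - (1 + \<delta> n) / 6 - (1 + \<delta> n) * (1 - \<delta> n) / 3 - (1 - \<delta> n)) / scale s (\<delta> n) + (1 + \<delta> n))
        \<longlonglongrightarrow> 0 + (1 + 0)"
      by (intro tendsto_add tendsto_const lim tendsto_divide_0[OF _ filterlim_at_top_imp_at_infinity[OF scale]])
    then have "(\<lambda>n. (1 - (1 + \<delta> n) / 6 - (1 + \<delta> n) * (1 - \<delta> n) / 3 - (1 - \<delta> n)) / scale s (\<delta> n) + (1 + \<delta> n)) \<longlonglongrightarrow> 1"
      by simp
    moreover have "eventually (\<lambda>n. (1 - (1 + \<delta> n) / 6 - (1 + \<delta> n) * (1 - \<delta> n) / 3 - (1 - \<delta> n)) / scale s (\<delta> n) + (1 + \<delta> n)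
        = profile_energy s (\<delta> n) / scale s (\<delta> n)) sequentially"
      using ev ev2 by eventually_elim (rule half[symmetric])
    ultimately show ?thesis by (rule Lim_transform_eventually)
  next
    case False
    then have s': "s > 1/2" using s by simp
    define c where "c = 2 * s * (1 - s) * (2 * s - 1) * (3 - 2 * s)"
    have c: "c > 0" using s s' by (simp add: c_def)
    \<comment> \<open>The reciprocal of the leading power w = d powr (1 - 2 * s). After division by
      w only expressions in d and v d remain, and both tend to 0.\<close>
    define v where "v d = d powr (2 * s - 1)" for d
    let ?Q = "\<lambda>d. 1 / (2 - 2 * s) - (1 + d) / (3 * (3 - 2 * s)) + (1 + d) * (1 - v d) / (2 * s - 1)
        - (1 + d) * (1 - v d * d) / (6 * s) - (v d - d) / (2 - 2 * s)"
    have quot: "profile_energy s d / scale s d = c * ?Q d" if d: "0 < d \<and> d < 1" for d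
    proof -
      define w where "w = d powr (1 - 2 * s)"
      have w: "w > 0" using d by (simp add: w_def)
      have wv: "w * v d = 1"
        using d powr_add[of d "1 - 2 * s" "2 * s - 1"] by (simp add: w_def v_def)
      have "profile_energy s d = w / (2 - 2 * s) - (1 + d) * w / (3 * (3 - 2 * s))
          + (1 + d) * ((w - w * v d) / (2 * s - 1)) - (1 + d) * (w - w * v d * d) / (6 * s)
          - (w * v d - w * d) / (2 - 2 * s)"
        using J[OF d] False wv by (simp add: tail_energy_def w_def)
      also have "\<dots> = w * ?Q d"
        by (simp only: distrib_left right_diff_distrib times_divide_eq_right mult_ac mult_1_left mult_1_right)
      finally have "profile_energy s d = w * ?Q d" .
      moreover have "scale s d = w / c" using False by (simp add: scale_def w_def c_def)
      ultimately show ?thesis using w c by simp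
    qed
    have v: "(\<lambda>n. v (\<delta> n)) \<longlonglongrightarrow> 0"
      unfolding v_def
      by (rule tendsto_zero_powrI[OF lim tendsto_const]) (use s' ev0 in \<open>auto elim: eventually_mono\<close>)
    have "(\<lambda>n. c * ?Q (\<delta> n)) \<longlonglongrightarrow> c * (1 / (2 - 2 * s) - (1 + 0) / (3 * (3 - 2 * s)) + (1 + 0) * (1 - 0) / (2 * s - 1)
        - (1 + 0) * (1 - 0 * 0) / (6 * s) - (0 - 0) / (2 - 2 * s))"
      using s s' by (intro tendsto_intros lim v) auto
    also have "c * (1 / (2 - 2 * s) - (1 + 0) / (3 * (3 - 2 * s)) + (1 + 0) * (1 - 0) / (2 * s - 1)
        - (1 + 0) * (1 - 0 * 0) / (6 * s) - (0 - 0) / (2 - 2 * s)) = 1"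
    proof -
      define a b e where "a = 1 - s" and "b = 2 * s - 1" and "e = 3 - 2 * s"
      have "a \<noteq> 0" "b \<noteq> 0" "e \<noteq> 0" "s \<noteq> 0" using s s' by (auto simp: a_def b_def e_def)
      then have "2 * s * a * b * e * (1 / (2 * a) - 1 / (3 * e) + 1 / b - 1 / (6 * s))
          = s * b * e - 2 / 3 * s * a * b + 2 * s * a * e - a * b * e / 3"
        by (simp add: field_simps)
      also have "\<dots> = 1" by (simp add: a_def b_def e_def field_simps)
      finally show ?thesis by (simp add: c_def a_def b_def e_def algebra_simps)
    qed
    finally have "(\<lambda>n. c * ?Q (\<delta> n)) \<longlonglongrightarrow> 1" .
    moreover have "eventually (\<lambda>n. c * ?Q (\<delta> n) = profile_energy s (\<delta> n) / scale s (\<delta> n)) sequentially"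
      using ev by eventually_elim (rule quot[symmetric])
    ultimately show ?thesis by (rule Lim_transform_eventually)
  qed
qed

theorem theorem1p5:
  fixes s :: real and \<delta> \<Lambda> T \<sigma> :: "nat \<Rightarrow> real" and L :: "nat \<Rightarrow> nat"
    and u :: "nat \<Rightarrow> real \<Rightarrow> real"
  assumes s: "1/2 \<le> s" "s < 1"
    and \<delta>_pos: "\<And>n. \<delta> n > 0"
    and \<delta>_lim: "\<delta> \<longlonglongrightarrow> 0"
    and \<Lambda>_def: "\<And>n. \<Lambda> n = 1 / \<delta> n"
    and L_pos: "\<And>n. L n \<ge> 1"
    and T_def: "\<And>n. T n = real (L n) * (\<Lambda> n + 1) * \<delta> n"
    and min: "\<And>n. is_minimizer (T n) (\<Lambda> n) (\<delta> n) s (u n)"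
    and \<sigma>_def: "\<And>n. \<sigma> n = (if s = 1/2 then ln (1 / \<delta> n)
                 else \<delta> n powr (1 - 2 * s) / (2 * s * (1 - s) * (2 * s - 1) * (3 - 2 * s)))"
  shows "(\<lambda>n. enn2real (energy (T n) s (u n)) / \<sigma> n) \<longlonglongrightarrow> 1"
proof -
  have \<delta>: "filterlim \<delta> (at_right 0) sequentially"
    using \<delta>_lim \<delta>_pos by (auto simp: filterlim_at less_le)
  have \<sigma>: "\<sigma> n = scale s (\<delta> n)" for n by (simp add: \<sigma>_def scale_def)
  have scale: "filterlim \<sigma> at_top sequentially"
    unfolding \<sigma> using filterlim_scale_at_top[OF s \<delta>] by (simp add: \<sigma>)
  have "eventually (\<lambda>n. \<sigma> n > 0) sequentially"
    using scale by (simp add: filterlim_at_top_dense)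
  moreover have "eventually (\<lambda>n. \<delta> n < 1) sequentially"
    using \<delta>_lim by (rule order_tendstoD) simp
  ultimately have ev: "eventually (\<lambda>n. \<sigma> n > 0 \<and> \<delta> n < 1) sequentially"
    by eventually_elim simp
  have lower: "(\<lambda>n. profile_energy s (\<delta> n) / \<sigma> n) \<longlonglongrightarrow> 1"
    unfolding \<sigma> by (rule profile_energy_asymp[OF s \<delta>])
  \<comment> \<open>The gap between the two energy bounds is constant in n, hence negligible against
    \<sigma>, which tends to infinity.\<close>
  have "(\<lambda>n. 1 / (2 * s) / \<sigma> n) \<longlonglongrightarrow> 0"
    by (rule tendsto_divide_0[OF tendsto_const filterlim_at_top_imp_at_infinity[OF scale]])
  from tendsto_add[OF lower this]
  have upper: "(\<lambda>n. (profile_energy s (\<delta> n) + 1 / (2 * s)) / \<sigma> n) \<longlonglongrightarrow> 1"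
    by (simp add: add_divide_distrib)
  have T: "T n = real (L n) * (1 / \<delta> n + 1) * \<delta> n" for n by (simp add: T_def \<Lambda>_def)
  have min': "is_minimizer (T n) (1 / \<delta> n) (\<delta> n) s (u n)" for n using min[of n] by (simp add: \<Lambda>_def)
  show ?thesis
  proof (rule tendsto_sandwich[OF _ _ lower upper])
    show "eventually (\<lambda>n. profile_energy s (\<delta> n) / \<sigma> n \<le> enn2real (energy (T n) s (u n)) / \<sigma> n) sequentially"
      using ev
    proof eventually_elim
      case (elim n)
      then show ?case
        using minimizer_energy_bounds(1)[OF s \<delta>_pos _ L_pos T min'] by (intro divide_right_mono) auto
    qed
    show "eventually (\<lambda>n. enn2real (energy (T n) s (u n)) / \<sigma> n \<le> (profile_energy s (\<delta> n) + 1 / (2 * s)) / \<sigma> n) sequentially"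
      using ev
    proof eventually_elim
      case (elim n)
      then show ?case
        using minimizer_energy_bounds(2)[OF s \<delta>_pos _ L_pos T min'] by (intro divide_right_mono) auto
    qed
  qed
qed

end
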